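(* Let $f(x)=\sum_{n=1}^N f_n(x)$ with $f_n:\mathbb{R}^d\to\mathbb{R}$, and let $\{(x_n(k))_{n=1}^N\}_{k\ge 1}$ be a D-SGD process, i.e., for $n=1,\dots,N$ and $k\ge 1$, $$x_n(k+1)=x_n(k)-\alpha_k\big(\nabla f_n(x_n(k))+\xi_n(k+1)\big)+\beta_k\sum_{\ell\in\Omega_n}\big(x_\ell(k)-x_n(k)\big),$$ where $\alpha_k,\beta_k\in(0,1]$ and $\Omega_n$ is the set of neighbors of $n$ in a graph $G$ on the vertex set $\{1,\dots,N\}$. Suppose: (1) each $f_n$ is continuously differentiable with locally Lipschitz continuous gradient; (2) for each $n$ there exist a radius $R>0$ and constants $C_1,C_2>0$ such that $\left\langle \frac{\nabla f_n(x)}{\|\nabla f_n(x)\|},\frac{x}{\|x\|}\right\rangle\ge C_1$ and $\|\nabla f_n(x)\|\le C_2\|x\|$ for all $\|x\|\ge R$; (3) $G$ is undirected, unweighted and connected; $\alpha_k=\Theta(k^{-\tau_\alpha})$ and $\beta_k=\Theta(k^{-\tau_\beta})$ with $0<\tau_\beta<\tau_\alpha$ and $\frac12<\tau_\alpha\le 1$; and for some $B>0$, for every $n$ and all $k\ge1$, $\mathbb{E}(\xi_n(k)\mid\mathcal{F}_{k-1})=0$ and $\mathbb{E}(\|\xi_n(k)\|^2\mid\mathcal{F}_{k-1})\le B$; (4) with $\mathrm{CP}_f=\{x\in\mathbb{R}^d:\nabla f(x)=0\}$, the set $\mathbb{R}\setminus f(\mathrm{CP}_f)$ is dense in $\mathbb{R}$.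 Then, given any fixed initial condition, for each $n=1,\dots,N$ the following hold with probability 1: (i) $\lim_{k\to\infty}\|x_n(k)-x_\ell(k)\|=0$ for all $\ell=1,\dots,N$; (ii) $x_n(k)$ converges to the set $\mathrm{CP}_f$ of critical points of $f$.
   Context: $\|\cdot\|$ is the Euclidean norm. $\mathcal{F}_k=\sigma(\{x(j),\xi(j)\}_{j=1}^k)$, where $x(k)=(x_n(k))_{n=1}^N$ and $\xi(k)=(\xi_n(k))_{n=1}^N$ are random vectors in $\mathbb{R}^{Nd}$ ($\mathcal F_0$ is trivial). The initial condition is a fixed deterministic point $x_0\in\mathbb{R}^{Nd}$, taken as $(x_n(1))_{n=1}^N=x_0$. $g(k)=\Theta(h(k))$ means there are $a,b>0$ with $a\,h(k)\le g(k)\le b\,h(k)$ for all $k$ sufficiently large. A sequence $x(k)$ converges to a set $S$ if $\lim_{k\to\infty}\inf_{y\in S}\|x(k)-y\|=0$. *)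

theory Defs
  imports
    "HOL-Probability.Probability"
    "HOL-Library.Landau_Symbols"
    "Graph_Theory.Digraph_Component"
begin

text \<open>Meaningful only at points of differentiability, where the gradient is unique.\<close>

definition grad :: "('a::real_inner \<Rightarrow> real) \<Rightarrow> 'a \<Rightarrow> 'a" where
  "grad f x = (THE D. GDERIV f x :> D)"

definition critical_points :: "('a::real_inner \<Rightarrow> real) \<Rightarrow> 'a set" where
  "critical_points f = {x. grad f x = 0}"

definition locally_lipschitz :: "('a::metric_space \<Rightarrow> 'b::metric_space) \<Rightarrow> bool" where
  "locally_lipschitz g \<longleftrightarrow> (\<forall>x. \<exists>u>0. \<exists>L. L-lipschitz_on (cball x u) g)"

text \<open>An undirected graph is a symmetric digraph here (\<^const>\<open>graph\<close>), so the out-neighbours of a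
  vertex are all of its neighbours.\<close>

definition neighbors :: "('n, 'e) pre_digraph \<Rightarrow> 'n \<Rightarrow> 'n set" where
  "neighbors G n = {l. (n, l) \<in> arcs_ends G}"

text \<open>The sigma-algebra generated by \<open>x j\<close> and \<open>xi j\<close> for \<open>1 \<le> j \<le> k\<close>; it is trivial
  for \<open>k = 0\<close>.\<close>

definition history ::
  "'w measure \<Rightarrow> (nat \<Rightarrow> 'w \<Rightarrow> 'b::topological_space) \<Rightarrow> (nat \<Rightarrow> 'w \<Rightarrow> 'b) \<Rightarrow> nat \<Rightarrow> 'w measure"
where
  "history M x xi k = sigma (space M)
     (\<Union>j\<in>{1..k}. {x j -` A \<inter> space M | A. A \<in> sets borel} \<union>
                  {xi j -` A \<inter> space M | A. A \<in> sets borel})"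

text \<open>Conditional expectation of an integrable random vector, taken componentwise.\<close>

definition vec_cond_exp ::
  "'w measure \<Rightarrow> 'w measure \<Rightarrow> ('w \<Rightarrow> real ^ 'd) \<Rightarrow> 'w \<Rightarrow> real ^ 'd" where
  "vec_cond_exp M F X \<omega> = (\<chi> i. real_cond_exp M F (\<lambda>\<omega>. X \<omega> $ i) \<omega>)"

text \<open>The distance to \<open>S\<close> is an infimum over \<open>S\<close>, hence infinite for empty \<open>S\<close>, whereas
  \<^const>\<open>infdist\<close> is then 0; the nonemptiness conjunct repairs this.\<close>

definition converges_to_set :: "(nat \<Rightarrow> 'a::metric_space) \<Rightarrow> 'a set \<Rightarrow> bool" where
  "converges_to_set X S \<longleftrightarrow> S \<noteq> {} \<and> (\<lambda>k. infdist (X k) S) \<longlonglongrightarrow> 0"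

end

theory Submission
  imports Defs
begin

text \<open>
  Probability enters only through the noise: \<open>\<Sum>\<alpha> k * xi (k + 1)\<close> is a series of martingale
  differences with summable variances, so it converges almost surely. The rest is pathwise.
  Filtering the noise by the consensus operator \<open>I - \<beta> k L\<close> gives a sequence \<open>u k \<longlonglongrightarrow> 0\<close>, and
  \<open>y k = x k - u k\<close> follows the noiseless recursion with the gradients evaluated at \<open>y k + u k\<close>.
  For large \<open>k\<close> the norm of \<open>y k\<close> cannot grow outside a fixed ball: if every agent is far from the
  origin the gradients point outward, and if one agent is near while another is far, the Laplacian
  term (of order \<open>\<beta> k\<close>) beats the gradient term (of order \<open>\<alpha> k\<close>). Boundedness gives
  consensus because \<open>\<alpha> k / \<beta> k \<longlonglongrightarrow> 0\<close>, and then the mean of \<open>y k\<close> is a gradient descent for the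
  sum of the \<open>f n\<close> with vanishing errors. Along it the objective value converges, because it can cross a
  regular value only downwards and regular values are dense; this forces the gradient to 0.
\<close>

section \<open>Contracting sequences\<close>

text \<open>Subtracting the tail sums of the noise directly would also remove it, but would leave
  \<open>b k\<close> times the Laplacian of the tail. Nothing makes this small against
  \<open>a k\<close>, so in the norm estimate it could outweigh the outward pull of the gradients. A
  filter that carries the Laplacian cancels this term exactly, and the only trace of the noise is a
  shift of the points at which the gradients are evaluated. The almost sure convergence of the noise
  series comes without a rate, so \<open>u k\<close> merely tends to 0 and the gradient errors need
  not be summable against the step sizes. Each estimate therefore has to absorb an arbitrary null
  sequence. Boundedness does so with half of the angular margin in the coercivity condition. The
  descent of the objective loses \<open>a k * \<epsilon>\<close> per step for a fixed \<epsilon>, so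
  the values need not be monotone even up to a summable error; this is why their convergence is
  argued level by level through regular values.\<close>

lemma summable_iff_shift_left: "summable (\<lambda>i. f (k + i)) \<longleftrightarrow> summable f"
  for f :: "nat \<Rightarrow> 'a::real_normed_vector"
  using summable_iff_shift[of f k] unfolding add.commute[of k] .

text \<open>Once \<open>e k\<close> is below \<epsilon>, the bound on the excess
  \<open>a k - \<epsilon>\<close> shrinks by the factor \<open>1 - b k\<close>, at most
  \<open>exp (- b k)\<close>, in each step; divergence of the sum of \<open>b\<close> drives the
  product of these factors to 0.\<close>

lemma contraction_tendsto_0:
  fixes a b e :: "nat \<Rightarrow> real"
  assumes rec: "\<And>k. a (Suc k) \<le> (1 - b k) * a k + b k * e k"
    and a: "\<And>k. 0 \<le> a k" and b: "\<And>k. 0 \<le> b k" "\<And>k. b k \<le> 1"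
    and nsum: "\<not> summable b" and e: "e \<longlonglongrightarrow> 0"
  shows "a \<longlonglongrightarrow> 0"
proof (rule LIMSEQ_I)
  fix r :: real assume r: "r > 0"
  define \<epsilon> where "\<epsilon> = r / 2"
  have "eventually (\<lambda>k. e k < \<epsilon>) sequentially"
    using e r by (intro order_tendstoD) (auto simp: \<epsilon>_def)
  then obtain K where K: "\<And>k. k \<ge> K \<Longrightarrow> e k < \<epsilon>" by (auto simp: eventually_sequentially)
  have step: "a (K + k) - \<epsilon> \<le> exp (- (\<Sum>i<k. b (K + i))) * a K" for k
  proof (induction k)
    case 0
    then show ?case using r by (simp add: \<epsilon>_def)
  next
    case (Suc k)
    let ?D = "exp (- (\<Sum>i<k. b (K + i))) * a K"
    have "a (K + Suc k) - \<epsilon> \<le> (1 - b (K + k)) * a (K + k) + b (K + k) * e (K + k) - \<epsilon>"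
      using rec[of "K + k"] by simp
    also have "\<dots> \<le> (1 - b (K + k)) * a (K + k) + b (K + k) * \<epsilon> - \<epsilon>"
      using K[of "K + k"] b(1)[of "K + k"] by (simp add: mult_left_mono)
    also have "\<dots> = (1 - b (K + k)) * (a (K + k) - \<epsilon>)" by (simp add: algebra_simps)
    also have "\<dots> \<le> (1 - b (K + k)) * ?D"
      using Suc b(2)[of "K + k"] by (intro mult_left_mono) auto
    also have "\<dots> \<le> exp (- b (K + k)) * ?D"
      using a[of K] exp_ge_add_one_self[of "- b (K + k)"] by (intro mult_right_mono) auto
    also have "\<dots> = exp (- (\<Sum>i<Suc k. b (K + i))) * a K"
      by (simp add: exp_add[symmetric] flip: exp_minus)
    finally show ?case .
  qed
  have "\<not> summable (\<lambda>i. b (K + i))" using nsum by (simp only: summable_iff_shift_left not_False_eq_True)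
  have "\<exists>k0. \<forall>k\<ge>k0. exp (- (\<Sum>i<k. b (K + i))) * a K < \<epsilon>"
  proof -
    have "filterlim (\<lambda>k. \<Sum>i<k. b (K + i)) at_top sequentially"
    proof (rule ccontr)
      assume "\<not> ?thesis"
      then obtain Z where Z: "\<And>N. \<exists>k\<ge>N. (\<Sum>i<k. b (K + i)) < Z"
        unfolding filterlim_at_top eventually_sequentially by (meson not_le)
      have "(\<Sum>i<N. b (K + i)) \<le> Z" for N
      proof -
        obtain k where "k \<ge> N" "(\<Sum>i<k. b (K + i)) < Z" using Z by blast
        moreover have "(\<Sum>i<N. b (K + i)) \<le> (\<Sum>i<k. b (K + i))"
          using \<open>k \<ge> N\<close> b by (intro sum_mono2) auto
        ultimately show ?thesis by simp
      qed
      then have "summable (\<lambda>i. b (K + i))"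
        using b by (intro summableI_nonneg_bounded) auto
      with \<open>\<not> summable (\<lambda>i. b (K + i))\<close> show False by simp
    qed
    then have "filterlim (\<lambda>k. - (\<Sum>i<k. b (K + i))) at_bot sequentially"
      by (simp add: filterlim_uminus_at_bot)
    then have "(\<lambda>k. exp (- (\<Sum>i<k. b (K + i)))) \<longlonglongrightarrow> 0"
      by (rule filterlim_compose[OF exp_at_bot])
    then have "(\<lambda>k. exp (- (\<Sum>i<k. b (K + i))) * a K) \<longlonglongrightarrow> 0 * a K" by (intro tendsto_intros)
    then have "eventually (\<lambda>k. exp (- (\<Sum>i<k. b (K + i))) * a K < \<epsilon>) sequentially"
      using r by (intro order_tendstoD) (auto simp: \<epsilon>_def)
    then show ?thesis by (simp add: eventually_sequentially)
  qed
  then obtain k0 where k0: "\<And>k. k \<ge> k0 \<Longrightarrow> exp (- (\<Sum>i<k. b (K + i))) * a K < \<epsilon>" by blast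
  have "norm (a n - 0) < r" if "n \<ge> K + k0" for n
  proof -
    from that obtain k where k: "n = K + k" "k \<ge> k0" by (metis add_le_cancel_left le_Suc_ex le_add1 le_trans)
    show ?thesis using step[of k] k0[OF k(2)] a[of n] by (simp add: k(1) \<epsilon>_def)
  qed
  then show "\<exists>no. \<forall>n\<ge>no. norm (a n - 0) < r" by blast
qed

lemma contraction_tendsto_0_eventually:
  fixes a b e :: "nat \<Rightarrow> real"
  assumes rec: "\<forall>\<^sub>F k in sequentially. a (Suc k) \<le> (1 - b k) * a k + b k * e k"
    and a: "\<And>k. 0 \<le> a k" and b: "\<forall>\<^sub>F k in sequentially. 0 \<le> b k" "\<forall>\<^sub>F k in sequentially. b k \<le> 1"
    and nsum: "\<not> summable b" and e: "e \<longlonglongrightarrow> 0"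
  shows "a \<longlonglongrightarrow> 0"
proof -
  have "\<forall>\<^sub>F k in sequentially. a (Suc k) \<le> (1 - b k) * a k + b k * e k \<and> 0 \<le> b k \<and> b k \<le> 1"
    using rec b by eventually_elim auto
  then obtain K where K: "\<And>k. k \<ge> K \<Longrightarrow> a (Suc k) \<le> (1 - b k) * a k + b k * e k \<and> 0 \<le> b k \<and> b k \<le> 1"
    by (auto simp: eventually_sequentially)
  have "(\<lambda>k. a (k + K)) \<longlonglongrightarrow> 0"
  proof (rule contraction_tendsto_0)
    show "\<not> summable (\<lambda>k. b (k + K))" using nsum by (simp add: summable_iff_shift)
    show "(\<lambda>k. e (k + K)) \<longlonglongrightarrow> 0" using e by (rule LIMSEQ_ignore_initial_segment)
  qed (use K a in auto)
  then show ?thesis by (rule LIMSEQ_offset)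
qed

section \<open>The graph Laplacian\<close>

text \<open>Signed so as to be positive semidefinite for symmetric neighbourhoods: the coupling term
  of the process is minus this.\<close>

definition laplacian :: "('n::finite \<Rightarrow> 'n set) \<Rightarrow> 'a::real_inner ^ 'n \<Rightarrow> 'a ^ 'n" where
  "laplacian nb y = (\<chi> n. \<Sum>l\<in>nb n. y $ n - y $ l)"

text \<open>The sum runs over ordered pairs, so for symmetric neighbourhoods each edge counts twice;
  hence the factor 1/2 in \<open>inner_laplacian\<close>.\<close>

definition dirichlet :: "('n::finite \<Rightarrow> 'n set) \<Rightarrow> 'a::real_inner ^ 'n \<Rightarrow> real" where
  "dirichlet nb y = (\<Sum>n\<in>UNIV. \<Sum>l\<in>nb n. (norm (y $ n - y $ l))\<^sup>2)"

definition vmean :: "'a::real_inner ^ 'n::finite \<Rightarrow> 'a" where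
  "vmean y = (\<Sum>n\<in>UNIV. y $ n) /\<^sub>R real CARD('n)"

lemma linear_laplacian: "linear (laplacian nb)"
  by (rule linearI)
     (simp_all add: laplacian_def vec_eq_iff sum.distrib[symmetric] scaleR_sum_right algebra_simps)

lemma linear_vmean: "linear vmean"
  by (rule linearI) (simp_all add: vmean_def sum.distrib scaleR_sum_right[symmetric] algebra_simps)

lemma vmean_const [simp]: "vmean (\<chi> n::'n::finite. c) = c"
  unfolding vmean_def by (simp add: scaleR_conv_of_real sum_constant_scaleR del: sum_constant)

lemma laplacian_const [simp]: "laplacian nb (\<chi> n. c) = 0"
  by (simp add: laplacian_def vec_eq_iff)

lemma norm_vec_power2: "(norm (y :: 'a::real_inner ^ 'n::finite))\<^sup>2 = (\<Sum>n\<in>UNIV. (norm (y $ n))\<^sup>2)"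
  by (simp add: norm_vec_def L2_set_def sum_nonneg)

lemma norm_sum_power2_le:
  "(norm (\<Sum>i\<in>A. g i))\<^sup>2 \<le> real (card A) * (\<Sum>i\<in>A. (norm (g i :: 'a::real_inner))\<^sup>2)"
proof -
  have "(norm (\<Sum>i\<in>A. g i))\<^sup>2 \<le> (\<Sum>i\<in>A. norm (g i))\<^sup>2"
    by (intro power_mono norm_sum) auto
  also have "\<dots> \<le> (\<Sum>i\<in>A. (norm (g i))\<^sup>2) * real (card A)"
    by (rule sum_squared_le_sum_of_squares)
  finally show ?thesis by (simp add: mult.commute)
qed

lemma norm_vmean_le: "norm (vmean (y :: 'a::real_inner ^ 'n::finite)) \<le> norm y"
proof -
  have "norm (\<Sum>n\<in>UNIV. y $ n) \<le> (\<Sum>n\<in>(UNIV::'n set). norm y)"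
    by (intro sum_norm_le Finite_Cartesian_Product.norm_nth_le)
  then show ?thesis by (simp add: vmean_def divide_simps mult.commute)
qed

lemma dirichlet_nonneg: "0 \<le> dirichlet nb y"
  by (simp add: dirichlet_def sum_nonneg)

lemma norm_laplacian_le:
  "(norm (laplacian nb (y :: 'a::real_inner ^ 'n::finite)))\<^sup>2 \<le> real CARD('n) * dirichlet nb y"
proof -
  have "(norm (laplacian nb y))\<^sup>2 = (\<Sum>n\<in>UNIV. (norm (\<Sum>l\<in>nb n. y $ n - y $ l))\<^sup>2)"
    by (simp add: norm_vec_power2 laplacian_def)
  also have "\<dots> \<le> (\<Sum>n\<in>UNIV. real (card (nb n)) * (\<Sum>l\<in>nb n. (norm (y $ n - y $ l))\<^sup>2))"
    by (intro sum_mono norm_sum_power2_le)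
  also have "\<dots> \<le> (\<Sum>n\<in>UNIV. real CARD('n) * (\<Sum>l\<in>nb n. (norm (y $ n - y $ l))\<^sup>2))"
    by (intro sum_mono mult_right_mono) (auto intro!: sum_nonneg card_mono)
  also have "\<dots> = real CARD('n) * dirichlet nb y" by (simp add: dirichlet_def sum_distrib_left)
  finally show ?thesis .
qed

locale connected_neighborhoods =
  fixes nb :: "'n::finite \<Rightarrow> 'n set"
  assumes nb_sym: "l \<in> nb n \<Longrightarrow> n \<in> nb l"
    and nb_connected: "(n, m) \<in> {(a, b). b \<in> nb a}\<^sup>*"
begin

lemma sum_nb_swap: "(\<Sum>n\<in>UNIV. \<Sum>l\<in>nb n. g n l) = (\<Sum>n\<in>UNIV. \<Sum>l\<in>nb n. g l n)"
  for g :: "'n \<Rightarrow> 'n \<Rightarrow> 'c::comm_monoid_add"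
proof -
  have "(\<Sum>n\<in>UNIV. \<Sum>l\<in>nb n. g n l) = (\<Sum>n\<in>UNIV. \<Sum>l | l \<in> UNIV \<and> l \<in> nb n. g n l)" by simp
  also have "\<dots> = (\<Sum>l\<in>UNIV. \<Sum>n | n \<in> UNIV \<and> l \<in> nb n. g n l)"
    by (rule sum.swap_restrict) auto
  also have "\<dots> = (\<Sum>n\<in>UNIV. \<Sum>l\<in>nb n. g l n)"
    by (intro sum.cong refl) (auto dest: nb_sym)
  finally show ?thesis .
qed

lemma vmean_laplacian: "vmean (laplacian nb (y :: 'a::real_inner ^ 'n)) = 0"
proof -
  have "(\<Sum>n\<in>UNIV. \<Sum>l\<in>nb n. y $ l) = (\<Sum>n\<in>UNIV. \<Sum>l\<in>nb n. y $ n)" by (rule sum_nb_swap)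
  then have "(\<Sum>n\<in>UNIV. laplacian nb y $ n) = 0"
    by (simp add: laplacian_def sum_subtractf del: sum_constant)
  then show ?thesis by (simp add: vmean_def)
qed

lemma inner_laplacian: "y \<bullet> laplacian nb (y :: 'a::real_inner ^ 'n) = dirichlet nb y / 2"
proof -
  have "y \<bullet> laplacian nb y = (\<Sum>n\<in>UNIV. \<Sum>l\<in>nb n. y $ n \<bullet> (y $ n - y $ l))"
    by (simp add: inner_vec_def laplacian_def inner_sum_right)
  moreover have "\<dots> = (\<Sum>n\<in>UNIV. \<Sum>l\<in>nb n. y $ l \<bullet> (y $ l - y $ n))" by (rule sum_nb_swap)
  moreover have "dirichlet nb y = (\<Sum>n\<in>UNIV. \<Sum>l\<in>nb n. y $ n \<bullet> (y $ n - y $ l) + y $ l \<bullet> (y $ l - y $ n))"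
    by (simp add: dirichlet_def power2_norm_eq_inner inner_diff_left inner_diff_right inner_commute algebra_simps)
  ultimately show ?thesis by (simp add: sum.distrib)
qed

text \<open>Along a path from \<open>n\<close> to \<open>m\<close> every edge contributes at most
  the root of the energy, because its squared difference is one summand of it. The constant for a
  pair is thus a path length, and there are finitely many pairs.\<close>

lemma dirichlet_bounds_differences:
  "\<exists>C>0. \<forall>(y :: 'a::real_inner ^ 'n) n m. norm (y $ n - y $ m) \<le> C * sqrt (dirichlet nb y)"
proof -
  have *: "\<exists>C\<ge>0. \<forall>y :: 'a ^ 'n. norm (y $ n - y $ m) \<le> C * sqrt (dirichlet nb y)" for n m
    using nb_connected[of n m]
  proof (induction rule: rtrancl_induct)
    case base
    show ?case by (rule exI[of _ 0]) auto
  next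
    case (step p q)
    then obtain C where C: "C \<ge> 0" "\<And>y :: 'a ^ 'n. norm (y $ n - y $ p) \<le> C * sqrt (dirichlet nb y)"
      by blast
    have "norm (y $ n - y $ q) \<le> (C + 1) * sqrt (dirichlet nb y)" for y :: "'a ^ 'n"
    proof -
      have "(norm (y $ p - y $ q))\<^sup>2 \<le> (\<Sum>l\<in>nb p. (norm (y $ p - y $ l))\<^sup>2)"
        using step by (intro member_le_sum) auto
      also have "\<dots> \<le> dirichlet nb y"
        unfolding dirichlet_def by (rule member_le_sum[of p]) (auto intro!: sum_nonneg)
      finally have "norm (y $ p - y $ q) \<le> sqrt (dirichlet nb y)" by (rule real_le_rsqrt)
      moreover have "norm (y $ n - y $ q) \<le> norm (y $ n - y $ p) + norm (y $ p - y $ q)"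
        using norm_triangle_ineq[of "y $ n - y $ p" "y $ p - y $ q"] by simp
      ultimately show ?thesis using C(2)[of y] by (simp add: algebra_simps)
    qed
    with C(1) show ?case by (intro exI[of _ "C + 1"]) auto
  qed
  then obtain C where C: "\<And>n m. C n m \<ge> 0"
    "\<And>n m (y :: 'a ^ 'n). norm (y $ n - y $ m) \<le> C n m * sqrt (dirichlet nb y)"
    by metis
  define D where "D = 1 + (\<Sum>n\<in>UNIV. \<Sum>m\<in>UNIV. C n m)"
  have CD: "C n m \<le> D" for n m
  proof -
    have "C n m \<le> (\<Sum>m\<in>UNIV. C n m)" using C(1) by (intro member_le_sum) auto
    also have "\<dots> \<le> (\<Sum>n\<in>UNIV. \<Sum>m\<in>UNIV. C n m)"
      using C(1) by (intro member_le_sum[of n UNIV "\<lambda>n. \<Sum>m\<in>UNIV. C n m"]) (auto intro!: sum_nonneg)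
    finally show ?thesis by (simp add: D_def)
  qed
  show ?thesis
  proof (intro exI[of _ D] conjI allI)
    show "D > 0" using C(1) by (auto simp: D_def intro!: add_pos_nonneg sum_nonneg)
    fix y :: "'a ^ 'n" and n m
    have "norm (y $ n - y $ m) \<le> C n m * sqrt (dirichlet nb y)" by (rule C(2))
    also have "\<dots> \<le> D * sqrt (dirichlet nb y)" using CD by (intro mult_right_mono) (auto simp: dirichlet_nonneg)
    finally show "norm (y $ n - y $ m) \<le> D * sqrt (dirichlet nb y)" .
  qed
qed

text \<open>Stands in for the spectral gap of a connected graph: if the mean is 0, then
  \<open>y $ n\<close> is the average over \<open>m\<close> of \<open>y $ n - y $ m\<close>, and
  such differences are controlled by the energy.\<close>

lemma poincare:
  "\<exists>C>0. \<forall>y :: 'a::real_inner ^ 'n. vmean y = 0 \<longrightarrow> (norm y)\<^sup>2 \<le> C * dirichlet nb y"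
proof -
  obtain C where C: "C > 0" "\<And>(y :: 'a ^ 'n) n m. norm (y $ n - y $ m) \<le> C * sqrt (dirichlet nb y)"
    using dirichlet_bounds_differences by metis
  have "(norm y)\<^sup>2 \<le> (real CARD('n) * C\<^sup>2) * dirichlet nb y" if y: "vmean y = 0" for y :: "'a ^ 'n"
  proof -
    have "(norm (y $ n))\<^sup>2 \<le> C\<^sup>2 * dirichlet nb y" for n
    proof -
      have "(\<Sum>m\<in>UNIV. y $ n - y $ m) = real CARD('n) *\<^sub>R y $ n"
        using y by (simp add: sum_subtractf vmean_def scaleR_conv_of_real sum_constant_scaleR)
      moreover have "norm (\<Sum>m\<in>UNIV. y $ n - y $ m) \<le> (\<Sum>m\<in>(UNIV::'n set). C * sqrt (dirichlet nb y))"
        by (intro sum_norm_le C)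
      ultimately have "norm (y $ n) \<le> C * sqrt (dirichlet nb y)" by simp
      then have "(norm (y $ n))\<^sup>2 \<le> (C * sqrt (dirichlet nb y))\<^sup>2" by (intro power_mono) auto
      then show ?thesis by (simp add: power_mult_distrib dirichlet_nonneg)
    qed
    then have "(norm y)\<^sup>2 \<le> (\<Sum>n\<in>(UNIV::'n set). C\<^sup>2 * dirichlet nb y)"
      unfolding norm_vec_power2 by (intro sum_mono)
    then show ?thesis by simp
  qed
  with C(1) show ?thesis by (intro exI[of _ "real CARD('n) * C\<^sup>2"]) auto
qed

text \<open>In the expanded square the cross term gains \<open>b * dirichlet nb y\<close>, the
  quadratic term returns at most half of it for small \<open>b\<close>, and the Poincare inequality
  turns the rest into a fraction of the squared norm.\<close>

lemma laplacian_contraction: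
  "\<exists>c>0. \<exists>b0>0. \<forall>(y :: 'a::real_inner ^ 'n) b. vmean y = 0 \<longrightarrow> 0 \<le> b \<longrightarrow> b \<le> b0 \<longrightarrow>
     norm (y - b *\<^sub>R laplacian nb y) \<le> (1 - c * b) * norm y"
proof -
  obtain C where C: "C > 0" "\<And>y :: 'a ^ 'n. vmean y = 0 \<Longrightarrow> (norm y)\<^sup>2 \<le> C * dirichlet nb y"
    using poincare by metis
  define N where "N = real CARD('n)"
  have N: "N > 0" by (simp add: N_def)
  \<comment> \<open>The squared norm shrinks by the factor \<open>1 - b / (2 * C)\<close>, which is
    \<open>1 - 2 * (c * b)\<close> and so at most the square of \<open>1 - c * b\<close>. In
    \<open>b0\<close> the bound \<open>1 / (2 * N)\<close> tames the quadratic term, and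
    \<open>1 / c\<close> keeps \<open>1 - c * b\<close> nonnegative.\<close>
  define c where "c = 1 / (4 * C)"
  define b0 where "b0 = min (1 / (2 * N)) (1 / c)"
  have c: "c > 0" using C by (simp add: c_def)
  have b0: "b0 > 0" using N c by (simp add: b0_def)
  have "norm (y - b *\<^sub>R laplacian nb y) \<le> (1 - c * b) * norm y"
    if y: "vmean y = 0" and b: "0 \<le> b" "b \<le> b0" for y :: "'a ^ 'n" and b
  proof (rule power2_le_imp_le)
    have "b \<le> 1 / (2 * N)" using b by (simp add: b0_def)
    then have bN: "b * N \<le> 1 / 2" using N by (simp add: field_simps)
    have "b \<le> 1 / c" using b by (simp add: b0_def)
    then have bc: "c * b \<le> 1" using c by (simp add: field_simps)
    have "(norm (y - b *\<^sub>R laplacian nb y))\<^sup>2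
        = (norm y)\<^sup>2 - 2 * b * (y \<bullet> laplacian nb y) + b\<^sup>2 * (norm (laplacian nb y))\<^sup>2"
      unfolding power2_norm_eq_inner
      by (simp add: inner_diff_left inner_diff_right inner_commute power2_eq_square algebra_simps)
    also have "\<dots> \<le> (norm y)\<^sup>2 - b * dirichlet nb y + b\<^sup>2 * (N * dirichlet nb y)"
      using norm_laplacian_le[of nb y] by (auto simp: inner_laplacian N_def intro!: mult_left_mono)
    also have "b\<^sup>2 * (N * dirichlet nb y) \<le> (1 / 2) * (b * dirichlet nb y)"
      using mult_right_mono[OF bN, of "b * dirichlet nb y"] b dirichlet_nonneg[of nb y]
      by (simp add: power2_eq_square mult_ac)
    also have "(norm y)\<^sup>2 - b * dirichlet nb y + (1 / 2) * (b * dirichlet nb y)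
        = (norm y)\<^sup>2 - (b / 2) * dirichlet nb y" by simp
    also have "\<dots> \<le> (norm y)\<^sup>2 - (b / 2) * ((norm y)\<^sup>2 / C)"
      using C(2)[OF y] C(1) b by (intro diff_left_mono mult_left_mono) (auto simp: field_simps)
    also have "\<dots> = (1 - 2 * (c * b)) * (norm y)\<^sup>2" using C(1) by (simp add: c_def field_simps)
    also have "\<dots> \<le> (1 - c * b)\<^sup>2 * (norm y)\<^sup>2"
      by (intro mult_right_mono) (auto simp: power2_diff)
    finally show "(norm (y - b *\<^sub>R laplacian nb y))\<^sup>2 \<le> ((1 - c * b) * norm y)\<^sup>2"
      by (simp add: power_mult_distrib)
    show "0 \<le> (1 - c * b) * norm y" using bc by simp
  qed
  with c b0 show ?thesis by blast
qed

end

section \<open>Gradient descent with vanishing errors\<close>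

text \<open>If the sequence returned forever to a closed set free of zeros of \<open>h\<close>, then
  by compactness \<open>norm (h z)\<close> would have a positive minimum on the part of that set
  that lies in the closure of the orbit. Applied to the whole space this gives the existence of a
  zero, applied to the points at distance at least \<epsilon> from the zeros it gives the
  convergence.\<close>

lemma converges_to_zero_set:
  fixes y :: "nat \<Rightarrow> 'a::heine_borel" and h :: "'a \<Rightarrow> 'b::real_normed_vector"
  assumes bdd: "bounded (range y)" and h: "continuous_on UNIV h" and lim: "(\<lambda>k. h (y k)) \<longlonglongrightarrow> 0"
  shows "converges_to_set y {z. h z = 0}"
proof -
  let ?Z = "{z. h z = 0}" and ?K = "closure (range y)"
  have K: "compact ?K" using bdd by (simp add: compact_closure)
  have yK: "y k \<in> ?K" for k using closure_subset[of "range y"] by auto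
  have away: False
    if C: "closed C" and freq: "\<exists>\<^sub>F k in sequentially. y k \<in> C" and nz: "\<And>z. z \<in> C \<Longrightarrow> h z \<noteq> 0" for C
  proof -
    have comp: "compact (?K \<inter> C)" using K C by (rule compact_Int_closed)
    have ne: "?K \<inter> C \<noteq> {}" using freq yK by (auto dest: frequently_ex)
    obtain z where z: "z \<in> ?K \<inter> C" "\<And>w. w \<in> ?K \<inter> C \<Longrightarrow> norm (h z) \<le> norm (h w)"
      using continuous_attains_inf[OF comp ne continuous_on_norm[OF continuous_on_subset[OF h subset_UNIV]]] by blast
    have "norm (h z) > 0" using nz z(1) by auto
    then have "\<forall>\<^sub>F k in sequentially. norm (h (y k)) < norm (h z)"
      using order_tendstoD(2)[OF tendsto_norm[OF lim], of "norm (h z)"] by simp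
    then have "\<exists>\<^sub>F k in sequentially. y k \<in> C \<and> norm (h (y k)) < norm (h z)"
      by (rule frequently_eventually_conj[OF freq, THEN frequently_elim1]) auto
    then obtain k where "y k \<in> C" "norm (h (y k)) < norm (h z)" by (auto dest: frequently_ex)
    with z(2)[of "y k"] yK[of k] show False by auto
  qed
  have ne: "?Z \<noteq> {}" using away[of UNIV] by auto
  have "(\<lambda>k. infdist (y k) ?Z) \<longlonglongrightarrow> 0"
  proof (rule ccontr)
    assume "\<not> ?thesis"
    then obtain \<epsilon> where \<epsilon>: "\<epsilon> > 0" "\<not> (\<forall>\<^sub>F k in sequentially. dist (infdist (y k) ?Z) 0 < \<epsilon>)"
      by (auto simp: tendsto_iff)
    show False
    proof (rule away[of "{z. \<epsilon> \<le> infdist z ?Z}"])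
      show "closed {z. \<epsilon> \<le> infdist z ?Z}"
        by (intro closed_Collect_le continuous_on_const continuous_on_infdist continuous_on_id)
      show "\<exists>\<^sub>F k in sequentially. y k \<in> {z. \<epsilon> \<le> infdist z ?Z}"
        using \<epsilon>(2) by (simp add: frequently_def infdist_nonneg not_le)
      show "h z \<noteq> 0" if "z \<in> {z. \<epsilon> \<le> infdist z ?Z}" for z
        using that \<epsilon>(1) infdist_zero[of z ?Z] by auto
    qed
  qed
  with ne show ?thesis by (simp add: converges_to_set_def)
qed

lemma gderiv_mvt:
  assumes "\<And>z. GDERIV F z :> h z"
  shows "\<exists>z\<in>closed_segment x y. F y - F x = (y - x) \<bullet> h z"
proof -
  have d: "((\<lambda>t. F (x + t *\<^sub>R (y - x))) has_derivative (\<lambda>s. (s *\<^sub>R (y - x)) \<bullet> h (x + t *\<^sub>R (y - x)))) (at t within {0..1})"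
    for t :: real
  proof -
    have "((\<lambda>t. x + t *\<^sub>R (y - x)) has_derivative (\<lambda>s. s *\<^sub>R (y - x))) (at t within {0..1})"
      by (auto intro!: derivative_eq_intros)
    moreover have "(F has_derivative (\<lambda>v. v \<bullet> h (x + t *\<^sub>R (y - x)))) (at (x + t *\<^sub>R (y - x)))"
      using assms by (simp add: gderiv_def)
    ultimately show ?thesis by (rule has_derivative_compose)
  qed
  obtain t where t: "t \<in> {0..1}" "F (x + 1 *\<^sub>R (y - x)) - F (x + 0 *\<^sub>R (y - x)) = ((1 - 0) *\<^sub>R (y - x)) \<bullet> h (x + t *\<^sub>R (y - x))"
    using mvt_very_simple[OF zero_le_one, of "\<lambda>t. F (x + t *\<^sub>R (y - x))"
        "\<lambda>t s. (s *\<^sub>R (y - x)) \<bullet> h (x + t *\<^sub>R (y - x))"] d by auto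
  have "x + t *\<^sub>R (y - x) \<in> closed_segment x y"
    using t(1) by (auto simp: in_segment algebra_simps intro!: exI[of _ t])
  with t(2) show ?thesis by auto
qed

lemma summable_if_shifted_partial_sums_bounded:
  fixes a :: "nat \<Rightarrow> real"
  assumes "\<And>k. 0 \<le> a k" "\<And>m. (\<Sum>i<m. a (k + i)) \<le> c"
  shows "summable a"
proof -
  have "summable (\<lambda>i. a (k + i))" using assms by (intro summableI_nonneg_bounded) auto
  then show ?thesis by (simp only: summable_iff_shift_left)
qed

lemma perturbed_gradient_descent:
  fixes F :: "'a::euclidean_space \<Rightarrow> real" and y :: "nat \<Rightarrow> 'a"
  assumes deriv: "\<And>z. GDERIV F z :> h z" and h: "continuous_on UNIV h"
    and bdd: "bounded (range y)"
    and rec: "\<And>k. y (Suc k) = y k - a k *\<^sub>R (h (y k) + e k)"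
    and a: "\<And>k. 0 \<le> a k" "a \<longlonglongrightarrow> 0" "\<not> summable a" and e: "e \<longlonglongrightarrow> 0"
    and dense: "closure (UNIV - F ` {z. h z = 0}) = (UNIV :: real set)"
  shows "(\<lambda>k. h (y k)) \<longlonglongrightarrow> 0"
proof -
  obtain r where r: "\<And>k. y k \<in> cball 0 r" using bdd by (force simp: bounded_iff)
  \<comment> \<open>A ball rather than the closure of the orbit: by convexity it also contains the
    mean value points between consecutive iterates.\<close>
  let ?K = "cball (0::'a) r"
  have contF: "continuous_on UNIV F"
    using deriv by (auto simp: continuous_on_eq_continuous_at gderiv_def intro: has_derivative_continuous)
  have "bounded (h ` ?K)"
    by (intro compact_imp_bounded compact_continuous_image continuous_on_subset[OF h]) auto
  then obtain H where H: "H > 0" "\<And>z. z \<in> ?K \<Longrightarrow> norm (h z) \<le> H"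
    by (auto simp: bounded_pos)
  have unif: "uniformly_continuous_on ?K h"
    by (intro compact_uniformly_continuous continuous_on_subset[OF h]) auto
  have diff0: "(\<lambda>k. y (Suc k) - y k) \<longlonglongrightarrow> 0"
  proof -
    have "bounded (range (\<lambda>k. h (y k) + e k))"
    proof -
      have "bounded (range e)" using e by (metis Bseq_eq_bounded convergentI convergent_imp_Bseq)
      moreover have "bounded (range (\<lambda>k. h (y k)))" using H(2) r by (auto simp: bounded_iff)
      ultimately show ?thesis using bounded_plus_comp[of "\<lambda>k. h (y k)" UNIV e] by simp
    qed
    then have "Bfun (\<lambda>k. h (y k) + e k) sequentially" by (simp add: Bseq_eq_bounded)
    moreover have "Zfun a sequentially" using a(2) by (simp add: tendsto_Zfun_iff)
    ultimately have "Zfun (\<lambda>k. a k *\<^sub>R (h (y k) + e k)) sequentially"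
      by (rule bounded_bilinear.Zfun_prod_Bfun[OF bounded_bilinear_scaleR, rotated])
    then have "(\<lambda>k. - (a k *\<^sub>R (h (y k) + e k))) \<longlonglongrightarrow> - 0"
      by (intro tendsto_minus) (simp add: tendsto_Zfun_iff)
    then show ?thesis by (simp add: rec)
  qed
  have mvt: "\<exists>z\<in>?K. norm (z - y k) \<le> norm (y (Suc k) - y k) \<and> F (y (Suc k)) - F (y k) = (y (Suc k) - y k) \<bullet> h z" for k
  proof -
    obtain z where z: "z \<in> closed_segment (y k) (y (Suc k))" "F (y (Suc k)) - F (y k) = (y (Suc k) - y k) \<bullet> h z"
      using gderiv_mvt[OF deriv] by blast
    have "z \<in> ?K" using z(1) r closed_segment_subset[OF r[of k] r[of "Suc k"] convex_cball] by blast
    moreover have "norm (z - y k) \<le> norm (y (Suc k) - y k)" using z(1) by (metis segment_bound(1) norm_minus_commute)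
    ultimately show ?thesis using z(2) by blast
  qed
  have descent: "\<forall>\<^sub>F k in sequentially. F (y (Suc k)) \<le> F (y k) - a k * ((norm (h (y k)))\<^sup>2 - \<epsilon>)"
    if "\<epsilon> > 0" for \<epsilon>
  proof -
    \<comment> \<open>Two errors may cost \<epsilon> / 2 each: the gradient is taken at the mean
      value point instead of \<open>y k\<close>, and \<open>e k\<close> is added. Both get
      multiplied by a gradient of norm at most \<open>H\<close>.\<close>
    have "\<epsilon> / (2 * H) > 0" using that H by simp
    then obtain d where d: "d > 0" "\<And>z w. z \<in> ?K \<Longrightarrow> w \<in> ?K \<Longrightarrow> dist w z < d \<Longrightarrow> dist (h w) (h z) < \<epsilon> / (2 * H)"
      using unif unfolding uniformly_continuous_on_def by metis
    have "\<forall>\<^sub>F k in sequentially. norm (y (Suc k) - y k) < d"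
      using order_tendstoD(2)[OF tendsto_norm[OF diff0], of d] d(1) by simp
    moreover have "\<forall>\<^sub>F k in sequentially. norm (e k) < \<epsilon> / (2 * H)"
      using order_tendstoD(2)[OF tendsto_norm[OF e]] \<open>\<epsilon> / (2 * H) > 0\<close> by simp
    ultimately show ?thesis
    proof eventually_elim
      case (elim k)
      obtain z where z: "z \<in> ?K" "norm (z - y k) \<le> norm (y (Suc k) - y k)"
        "F (y (Suc k)) - F (y k) = (y (Suc k) - y k) \<bullet> h z" using mvt by blast
      have "norm (h z - h (y k)) \<le> \<epsilon> / (2 * H)"
        using d(2)[OF r[of k] z(1)] z(2) elim(1) by (simp add: dist_norm)
      then have 1: "norm (h (y k)) * norm (h z - h (y k)) \<le> H * (\<epsilon> / (2 * H))"
        using H(2)[OF r[of k]] H(1) by (intro mult_mono) auto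
      have 2: "norm (e k) * norm (h z) \<le> (\<epsilon> / (2 * H)) * H"
        using elim(2) H(2)[OF z(1)] H(1) that by (intro mult_mono) auto
      have "(h (y k) + e k) \<bullet> h z = (norm (h (y k)))\<^sup>2 + h (y k) \<bullet> (h z - h (y k)) + e k \<bullet> h z"
        by (simp add: power2_norm_eq_inner inner_diff_right inner_add_left)
      moreover have "\<bar>h (y k) \<bullet> (h z - h (y k))\<bar> \<le> \<epsilon> / 2"
        using order_trans[OF Cauchy_Schwarz_ineq2 1] H(1) by simp
      moreover have "\<bar>e k \<bullet> h z\<bar> \<le> \<epsilon> / 2"
        using order_trans[OF Cauchy_Schwarz_ineq2 2] H(1) by simp
      ultimately have "(h (y k) + e k) \<bullet> h z \<ge> (norm (h (y k)))\<^sup>2 - \<epsilon>" by linarith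
      then have "a k * ((h (y k) + e k) \<bullet> h z) \<ge> a k * ((norm (h (y k)))\<^sup>2 - \<epsilon>)"
        using a(1) by (rule mult_left_mono)
      moreover have "F (y (Suc k)) = F (y k) - a k * ((h (y k) + e k) \<bullet> h z)"
        using z(3) by (simp add: rec)
      ultimately show ?case by simp
    qed
  qed
  have Fdiff0: "(\<lambda>k. F (y (Suc k)) - F (y k)) \<longlonglongrightarrow> 0"
  proof (rule Lim_null_comparison)
    show "\<forall>\<^sub>F k in sequentially. norm (F (y (Suc k)) - F (y k)) \<le> H * norm (y (Suc k) - y k)"
    proof (rule always_eventually, rule allI)
      fix k
      obtain z where z: "z \<in> ?K" "F (y (Suc k)) - F (y k) = (y (Suc k) - y k) \<bullet> h z" using mvt by blast
      have "\<bar>(y (Suc k) - y k) \<bullet> h z\<bar> \<le> norm (y (Suc k) - y k) * norm (h z)" by (rule Cauchy_Schwarz_ineq2)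
      also have "\<dots> \<le> norm (y (Suc k) - y k) * H" using H(2)[OF z(1)] by (intro mult_left_mono) auto
      finally show "norm (F (y (Suc k)) - F (y k)) \<le> H * norm (y (Suc k) - y k)"
        using z(2) by (simp add: mult.commute)
    qed
    show "(\<lambda>k. H * norm (y (Suc k) - y k)) \<longlonglongrightarrow> 0"
      using tendsto_mult_right_zero[OF tendsto_norm_zero[OF diff0], of H] .
  qed
  \<comment> \<open>Near a regular value the sequence \<open>F (y k)\<close> can only decrease, so it crosses that value at most once.\<close>
  have one_sided: "\<forall>\<^sub>F k in sequentially. F (y k) \<le> c"
    if c: "c \<notin> F ` {z. h z = 0}" and freq: "\<not> (\<forall>\<^sub>F k in sequentially. c \<le> F (y k))" for c
  proof -
    have ne: "?K \<noteq> {}" using r by blast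
    \<comment> \<open>This function vanishes only at critical points of value \<open>c\<close>, of
      which there are none, so its minimum over the ball is positive. With \<kappa> half of the
      minimum, a value within \<kappa> of \<open>c\<close> forces a squared gradient of at least
      \<kappa>, exactly the loss allowed in \<open>descent\<close>.\<close>
    have "continuous_on ?K (\<lambda>z. \<bar>F z - c\<bar> + (norm (h z))\<^sup>2)"
      by (intro continuous_intros continuous_on_subset[OF h] continuous_on_subset[OF contF]) auto
    then obtain z0 where z0: "z0 \<in> ?K" "\<And>z. z \<in> ?K \<Longrightarrow> \<bar>F z0 - c\<bar> + (norm (h z0))\<^sup>2 \<le> \<bar>F z - c\<bar> + (norm (h z))\<^sup>2"
      using continuous_attains_inf[OF compact_cball ne] by blast
    define \<kappa> where "\<kappa> = (\<bar>F z0 - c\<bar> + (norm (h z0))\<^sup>2) / 2"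
    have "\<bar>F z0 - c\<bar> + (norm (h z0))\<^sup>2 > 0"
    proof (cases "h z0 = 0")
      case True
      then have "F z0 \<noteq> c" using c by blast
      then show ?thesis by (simp add: add_pos_nonneg)
    qed (simp add: add_nonneg_pos)
    then have \<kappa>: "\<kappa> > 0" by (simp add: \<kappa>_def)
    have reg: "(norm (h z))\<^sup>2 \<ge> \<kappa>" if "z \<in> ?K" "\<bar>F z - c\<bar> \<le> \<kappa>" for z
    proof -
      have "2 * \<kappa> \<le> \<bar>F z - c\<bar> + (norm (h z))\<^sup>2" using z0(2)[OF that(1)] by (simp add: \<kappa>_def)
      with that(2) show ?thesis by simp
    qed
    have "\<forall>\<^sub>F k in sequentially. \<bar>F (y (Suc k)) - F (y k)\<bar> < \<kappa>"
      using order_tendstoD(2)[OF tendsto_norm[OF Fdiff0], of \<kappa>] \<kappa> by simp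
    then have "\<forall>\<^sub>F k in sequentially. F (y k) \<le> c \<longrightarrow> F (y (Suc k)) \<le> c"
      using descent[OF \<kappa>]
    proof eventually_elim
      case (elim k)
      show ?case
      proof
        assume le: "F (y k) \<le> c"
        show "F (y (Suc k)) \<le> c"
        \<comment> \<open>Within \<kappa> of \<open>c\<close> the value does not increase; further
          below, a single step is too short to reach \<open>c\<close>.\<close>
        proof (cases "\<bar>F (y k) - c\<bar> \<le> \<kappa>")
          case True
          then have "(norm (h (y k)))\<^sup>2 - \<kappa> \<ge> 0" using reg[OF r] by simp
          then have "a k * ((norm (h (y k)))\<^sup>2 - \<kappa>) \<ge> 0" using a(1) by simp
          then show ?thesis using elim(2) le by linarith
        next
          case False
          then show ?thesis using elim(1) le by linarith
        qed
      qed
    qed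
    then obtain k0 where k0: "\<And>k. k \<ge> k0 \<Longrightarrow> F (y k) \<le> c \<Longrightarrow> F (y (Suc k)) \<le> c"
      by (auto simp: eventually_sequentially)
    obtain k1 where k1: "k1 \<ge> k0" "F (y k1) \<le> c"
      using freq by (force simp: eventually_sequentially not_le)
    have "F (y k) \<le> c" if "k \<ge> k1" for k
      using that by (induction rule: dec_induct) (use k0 k1 in auto)
    then show ?thesis by (auto simp: eventually_sequentially)
  qed
  have conv: "convergent (\<lambda>k. F (y k))"
  proof -
    have "bounded (F ` ?K)"
      by (intro compact_imp_bounded compact_continuous_image continuous_on_subset[OF contF]) auto
    then obtain b where b: "\<And>z. z \<in> ?K \<Longrightarrow> \<bar>F z\<bar> \<le> b"
      unfolding bounded_iff by (metis imageI real_norm_def)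
    \<comment> \<open>\<open>Sup A\<close> is the lower limit of the values. A regular
      \<open>c\<close> above it is not an eventual lower bound, hence by \<open>one_sided\<close> an
      eventual upper bound; by density such \<open>c\<close> lie arbitrarily close to
      \<open>Sup A\<close>, so the upper limit is the same.\<close>
    define A where "A = {c. \<forall>\<^sub>F k in sequentially. c \<le> F (y k)}"
    have "-b \<in> A" using b[OF r] by (auto simp: A_def abs_le_iff intro!: always_eventually) (metis minus_le_iff)
    then have Ane: "A \<noteq> {}" by blast
    have "c \<le> b" if "c \<in> A" for c
    proof -
      from that obtain k where "c \<le> F (y k)" unfolding A_def by (auto simp: eventually_sequentially)
      also have "\<dots> \<le> b" using b[OF r, of k] by linarith
      finally show ?thesis .
    qed
    then have Abdd: "bdd_above A" by (auto simp: bdd_above_def)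
    have "(\<lambda>k. F (y k)) \<longlonglongrightarrow> Sup A"
    proof (rule order_tendstoI)
      fix u assume "u < Sup A"
      then obtain c where c: "c \<in> A" "u < c" using less_cSup_iff[OF Ane Abdd] by blast
      then show "\<forall>\<^sub>F k in sequentially. u < F (y k)"
        unfolding A_def by (auto elim!: eventually_mono)
    next
      fix u assume u: "Sup A < u"
      have "open {Sup A<..<u}" "{Sup A<..<u} \<noteq> {}" using u dense_order_class.dense by auto
      then have "{Sup A<..<u} \<inter> (UNIV - F ` {z. h z = 0}) \<noteq> {}"
        using open_Int_closure_eq_empty[of "{Sup A<..<u}" "UNIV - F ` {z. h z = 0}"]
        unfolding dense Int_UNIV_right by blast
      then obtain c where c: "c \<in> {Sup A<..<u}" "c \<notin> F ` {z. h z = 0}" by blast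
      have "c \<notin> A" using c(1) cSup_upper[OF _ Abdd, of c] by auto
      then have "\<forall>\<^sub>F k in sequentially. F (y k) \<le> c" using one_sided[OF c(2)] by (simp add: A_def)
      then show "\<forall>\<^sub>F k in sequentially. F (y k) < u" using c(1) by (auto elim!: eventually_mono)
    qed
    then show ?thesis by (rule convergentI)
  qed
  show ?thesis
  proof (rule ccontr)
    assume "\<not> ?thesis"
    then obtain \<epsilon>' where "\<epsilon>' > 0" "\<not> (\<forall>\<^sub>F k in sequentially. norm (h (y k)) < \<epsilon>')"
      by (auto simp: tendsto_iff)
    define \<epsilon> where "\<epsilon> = \<epsilon>' / 2"
    have \<epsilon>: "\<epsilon> > 0" using \<open>\<epsilon>' > 0\<close> by (simp add: \<epsilon>_def)
    have freq: "\<exists>k\<ge>N. norm (h (y k)) \<ge> 2 * \<epsilon>" for N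
      using \<open>\<not> (\<forall>\<^sub>F k in sequentially. norm (h (y k)) < \<epsilon>')\<close>
      by (auto simp: eventually_sequentially \<epsilon>_def not_less)
    obtain d where d: "d > 0" "\<And>z w. z \<in> ?K \<Longrightarrow> w \<in> ?K \<Longrightarrow> dist w z < d \<Longrightarrow> dist (h w) (h z) < \<epsilon>"
      using unif \<epsilon> unfolding uniformly_continuous_on_def by metis
    \<comment> \<open>A gradient of norm at least \<epsilon> leaves a descent rate of at least
      \<kappa> after the loss \<kappa>. Since \<open>H + 1\<close> bounds
      \<open>h (y k) + e k\<close> once \<open>norm (e k) < 1\<close>, an accumulated step size
      \<theta> moves the iterate by at most \<open>d / 2\<close>.\<close>
    define \<kappa> where "\<kappa> = \<epsilon>\<^sup>2 / 2"
    have \<kappa>: "\<kappa> > 0" using \<epsilon> by (simp add: \<kappa>_def)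
    define \<theta> where "\<theta> = d / (2 * (H + 1))"
    have \<theta>: "\<theta> > 0" using d H by (simp add: \<theta>_def)
    have "\<forall>\<^sub>F k in sequentially. norm (e k) < 1"
      using order_tendstoD(2)[OF tendsto_norm[OF e], of 1] by simp
    then have "\<forall>\<^sub>F k in sequentially. norm (e k) < 1 \<and> F (y (Suc k)) \<le> F (y k) - a k * ((norm (h (y k)))\<^sup>2 - \<kappa>)"
      using descent[OF \<kappa>] by eventually_elim auto
    then obtain k0 where k0: "\<And>k. k \<ge> k0 \<Longrightarrow> norm (e k) < 1"
       "\<And>k. k \<ge> k0 \<Longrightarrow> F (y (Suc k)) \<le> F (y k) - a k * ((norm (h (y k)))\<^sup>2 - \<kappa>)"
      unfolding eventually_sequentially by blast
    have "\<exists>k1. \<forall>i\<ge>k1. \<forall>j\<ge>k1. norm (F (y i) - F (y j)) < \<kappa> * \<theta>"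
      using conv \<kappa> \<theta> by (intro CauchyD) (auto intro: convergent_Cauchy)
    then obtain k1 where k1: "\<And>i j. i \<ge> k1 \<Longrightarrow> j \<ge> k1 \<Longrightarrow> \<bar>F (y i) - F (y j)\<bar> < \<kappa> * \<theta>" by auto
    obtain k where k: "k \<ge> max k0 k1" "norm (h (y k)) \<ge> 2 * \<epsilon>" using freq by blast
    \<comment> \<open>The three claims sustain each other. While the accumulated step size is at
      most \<theta>, the iterate stays within \<open>d\<close> of \<open>y k\<close>, the gradient
      keeps norm at least \<epsilon>, and the value falls at rate \<kappa>. As the values vary by
      less than \<open>\<kappa> * \<theta>\<close>, the step sizes cannot accumulate beyond
      \<theta>, so this phase never ends and \<open>a\<close> would be summable.\<close>
    have ind: "norm (y (k + m) - y k) \<le> (H + 1) * (\<Sum>i<m. a (k + i)) \<and>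
        F (y (k + m)) \<le> F (y k) - \<kappa> * (\<Sum>i<m. a (k + i)) \<and> (\<Sum>i<m. a (k + i)) \<le> \<theta>" for m
    proof (induction m)
      case 0
      then show ?case using \<theta> by simp
    next
      case (Suc m)
      let ?s = "\<Sum>i<m. a (k + i)"
      have "norm (y (k + m) - y k) \<le> (H + 1) * \<theta>"
        using Suc H(1) mult_left_mono[of ?s \<theta> "H + 1"] by linarith
      also have "\<dots> = d / 2" using H(1) by (simp add: \<theta>_def divide_simps)
      also have "\<dots> < d" using d(1) by simp
      finally have "dist (h (y (k + m))) (h (y k)) < \<epsilon>"
        using d(2)[OF r[of k] r[of "k + m"]] by (simp add: dist_norm)
      then have "norm (h (y (k + m))) \<ge> \<epsilon>"
        using k(2) norm_triangle_ineq2[of "h (y k)" "h (y (k + m))"] by (simp add: dist_norm norm_minus_commute)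
      then have "(norm (h (y (k + m))))\<^sup>2 \<ge> \<epsilon>\<^sup>2" using \<epsilon> by (intro power_mono) auto
      then have "a (k + m) * ((norm (h (y (k + m))))\<^sup>2 - \<kappa>) \<ge> a (k + m) * \<kappa>"
        using a(1) by (intro mult_left_mono) (auto simp: \<kappa>_def)
      moreover have "F (y (Suc (k + m))) \<le> F (y (k + m)) - a (k + m) * ((norm (h (y (k + m))))\<^sup>2 - \<kappa>)"
        using k(1) by (intro k0) auto
      ultimately have F: "F (y (k + Suc m)) \<le> F (y k) - \<kappa> * (\<Sum>i<Suc m. a (k + i))"
        using Suc by (simp add: algebra_simps)
      have "norm (h (y (k + m)) + e (k + m)) \<le> H + 1"
        using norm_triangle_ineq[of "h (y (k + m))" "e (k + m)"] H(2)[OF r[of "k + m"]] k0(1)[of "k + m"] k(1)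
        by simp
      then have "norm (a (k + m) *\<^sub>R (h (y (k + m)) + e (k + m))) \<le> a (k + m) * (H + 1)"
        using a(1) by (auto simp: intro!: mult_left_mono)
      moreover have "y (k + Suc m) - y k = (y (k + m) - y k) - a (k + m) *\<^sub>R (h (y (k + m)) + e (k + m))"
        using rec[of "k + m"] by simp
      ultimately have "norm (y (k + Suc m) - y k) \<le> norm (y (k + m) - y k) + a (k + m) * (H + 1)"
        by (metis add_left_mono norm_triangle_ineq4 order_trans)
      then have Y: "norm (y (k + Suc m) - y k) \<le> (H + 1) * (\<Sum>i<Suc m. a (k + i))"
        using Suc by (simp add: algebra_simps)
      have "\<kappa> * (\<Sum>i<Suc m. a (k + i)) \<le> \<kappa> * \<theta>"
        using F k1[of k "k + Suc m"] k(1) by linarith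
      then have "(\<Sum>i<Suc m. a (k + i)) \<le> \<theta>" using \<kappa> by simp
      with Y F show ?case by blast
    qed
    have "summable a" using a(1) ind by (intro summable_if_shifted_partial_sums_bounded[of a k \<theta>]) auto
    with a(3) show False by simp
  qed
qed

section \<open>Transfer between asymptotically equal sequences, and gradients of sums\<close>

lemma converges_to_set_close:
  assumes y: "converges_to_set y S" and xy: "(\<lambda>k. dist (x k) (y k)) \<longlonglongrightarrow> 0"
  shows "converges_to_set x S"
proof -
  have "(\<lambda>k. infdist (x k) S) \<longlonglongrightarrow> 0"
  proof (rule tendsto_sandwich[of "\<lambda>_. 0"])
    show "\<forall>\<^sub>F k in sequentially. infdist (x k) S \<le> infdist (y k) S + dist (x k) (y k)"
      by (intro always_eventually allI infdist_triangle)
    show "(\<lambda>k. infdist (y k) S + dist (x k) (y k)) \<longlonglongrightarrow> 0"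
      using y xy tendsto_add_zero unfolding converges_to_set_def by blast
  qed (auto simp: infdist_nonneg)
  with y show ?thesis by (simp add: converges_to_set_def)
qed

lemma continuous_diff_tendsto_0:
  fixes g :: "'a::{heine_borel, real_normed_vector} \<Rightarrow> 'b::real_normed_vector"
  assumes g: "continuous_on UNIV g" and p: "bounded (range p)" and q: "bounded (range q)"
    and pq: "(\<lambda>k. p k - q k) \<longlonglongrightarrow> 0"
  shows "(\<lambda>k. g (p k) - g (q k)) \<longlonglongrightarrow> 0"
proof -
  let ?K = "closure (range p \<union> range q)"
  have "compact ?K" using p q by (simp add: compact_closure del: closure_Un)
  then have unif: "uniformly_continuous_on ?K g"
    by (intro compact_uniformly_continuous continuous_on_subset[OF g]) auto
  have K: "p k \<in> ?K" "q k \<in> ?K" for k using closure_subset[of "range p \<union> range q"] by auto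
  show ?thesis
  proof (rule tendstoI)
    fix \<epsilon> :: real assume "\<epsilon> > 0"
    then obtain d where d: "d > 0" "\<And>z w. z \<in> ?K \<Longrightarrow> w \<in> ?K \<Longrightarrow> dist w z < d \<Longrightarrow> dist (g w) (g z) < \<epsilon>"
      using unif unfolding uniformly_continuous_on_def by metis
    have "\<forall>\<^sub>F k in sequentially. dist (p k - q k) 0 < d" using pq d(1) by (rule tendstoD)
    then show "\<forall>\<^sub>F k in sequentially. dist (g (p k) - g (q k)) 0 < \<epsilon>"
    proof eventually_elim
      case (elim k)
      then show ?case using d(2)[OF K(2)[of k] K(1)[of k]] by (simp add: dist_norm)
    qed
  qed
qed

lemma gderiv_sum:
  assumes "\<And>i. i \<in> I \<Longrightarrow> GDERIV (f i) z :> g i"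
  shows "GDERIV (\<lambda>z. \<Sum>i\<in>I. f i z) z :> (\<Sum>i\<in>I. g i)"
  using assms unfolding gderiv_def inner_sum_right by (intro has_derivative_sum)

section \<open>Consensus and descent without randomness\<close>

text \<open>There are finitely many agents, so extreme radii and constants serve all of them;
  clearing denominators gives a form that can be used without asking whether the gradient is
  0.\<close>

lemma uniform_outward_cone:
  fixes g :: "'n::finite \<Rightarrow> 'a::real_inner \<Rightarrow> 'a"
  assumes "\<And>n. \<exists>R>0. \<exists>C1>0. \<exists>C2>0. \<forall>y. norm y \<ge> R \<longrightarrow>
      (g n y /\<^sub>R norm (g n y)) \<bullet> (y /\<^sub>R norm y) \<ge> C1 \<and> norm (g n y) \<le> C2 * norm y"
  obtains R c C where "R > 0" "c > 0" "C > 0"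
    "\<And>n y. norm y \<ge> R \<Longrightarrow> c * norm (g n y) * norm y \<le> g n y \<bullet> y"
    "\<And>n y. norm y \<ge> R \<Longrightarrow> norm (g n y) \<le> C * norm y"
proof -
  obtain R C1 C2 where pos: "\<And>n. R n > 0" "\<And>n. C1 n > 0" "\<And>n. C2 n > 0"
    and cone: "\<And>n y. norm y \<ge> R n \<Longrightarrow> (g n y /\<^sub>R norm (g n y)) \<bullet> (y /\<^sub>R norm y) \<ge> C1 n"
    and growth: "\<And>n y. norm y \<ge> R n \<Longrightarrow> norm (g n y) \<le> C2 n * norm y"
    using assms by metis
  define R0 where "R0 = Max (range R)"
  define c where "c = Min (range C1)"
  define C where "C = Max (range C2)"
  have R0: "R n \<le> R0" and c: "c \<le> C1 n" and C: "C2 n \<le> C" for n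
    by (auto simp: R0_def c_def C_def)
  have "R0 > 0" using pos(1) R0 less_le_trans by blast
  moreover have "c > 0" using pos(2) by (auto simp: c_def)
  moreover have "C > 0" using pos(3) C less_le_trans by blast
  moreover have "c * norm (g n y) * norm y \<le> g n y \<bullet> y" if "norm y \<ge> R0" for n y
  proof (cases "g n y = 0")
    case False
    have "norm y \<ge> R n" using that R0 order_trans by blast
    then have "c \<le> (g n y /\<^sub>R norm (g n y)) \<bullet> (y /\<^sub>R norm y)" using cone c order_trans by blast
    also have "\<dots> = (g n y \<bullet> y) / (norm (g n y) * norm y)"
      by (simp add: divide_inverse mult_ac)
    finally have le: "c \<le> (g n y \<bullet> y) / (norm (g n y) * norm y)" .
    have "0 < norm (g n y)" using False by simp
    moreover have "0 < norm y" using \<open>R0 > 0\<close> that by linarith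
    ultimately have "0 < norm (g n y) * norm y" by (rule mult_pos_pos)
    from le[unfolded pos_le_divide_eq[OF this]] show ?thesis by (simp only: mult.assoc)
  qed simp
  moreover have "norm (g n y) \<le> C * norm y" if "norm y \<ge> R0" for n y
  proof -
    have "norm (g n y) \<le> C2 n * norm y" using that R0 growth order_trans by blast
    also have "\<dots> \<le> C * norm y" using C by (intro mult_right_mono) auto
    finally show ?thesis .
  qed
  ultimately show thesis using that by blast
qed

lemma bounded_if_eventually_decreasing_beyond:
  fixes y :: "nat \<Rightarrow> 'a::real_normed_vector"
  assumes "\<forall>\<^sub>F k in sequentially. (norm (y (Suc k)))\<^sup>2 \<le> max ((norm (y k))\<^sup>2) c"
  shows "bounded (range y)"
proof -
  obtain K where K: "\<And>k. k \<ge> K \<Longrightarrow> (norm (y (Suc k)))\<^sup>2 \<le> max ((norm (y k))\<^sup>2) c"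
    using assms by (auto simp: eventually_sequentially)
  define d where "d = max ((norm (y K))\<^sup>2) c"
  have "(norm (y k))\<^sup>2 \<le> d" if "k \<ge> K" for k
    using that
  proof (induction rule: dec_induct)
    case (step m)
    then show ?case using K[of m] by (auto simp: d_def)
  qed (simp add: d_def)
  then have "norm (y (k + K)) \<le> sqrt d" for k by (simp add: real_le_rsqrt)
  then have "Bseq (\<lambda>k. y (k + K))" by (intro BseqI') auto
  then show ?thesis using Bseq_offset Bseq_eq_bounded by blast
qed

context connected_neighborhoods
begin

text \<open>The squared norm serves as Lyapunov function because coercivity speaks of the angle
  between each gradient and its own position: the gradient contribution splits into one term per
  agent, and only agents inside the ball can have a positive one.\<close>

lemma perturbed_consensus_descent_bounded:
  fixes g :: "'n \<Rightarrow> 'a::euclidean_space \<Rightarrow> 'a" and y u :: "nat \<Rightarrow> 'a ^ 'n"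
  assumes cont: "\<And>n. continuous_on UNIV (g n)"
    and coercive: "\<And>n. \<exists>R>0. \<exists>C1>0. \<exists>C2>0. \<forall>y. norm y \<ge> R \<longrightarrow>
      (g n y /\<^sub>R norm (g n y)) \<bullet> (y /\<^sub>R norm y) \<ge> C1 \<and> norm (g n y) \<le> C2 * norm y"
    and rec: "\<And>k. y (Suc k) = y k - b k *\<^sub>R laplacian nb (y k) - a k *\<^sub>R (\<chi> n. g n ((y k + u k) $ n))"
    and pos: "\<And>k. 0 < a k" "\<And>k. 0 < b k"
    and lim: "a \<longlonglongrightarrow> 0" "b \<longlonglongrightarrow> 0" "(\<lambda>k. a k / b k) \<longlonglongrightarrow> 0"
    and u: "u \<longlonglongrightarrow> 0"
  shows "bounded (range y)"
proof -
  obtain R c C2 where const: "R > 0" "c > 0" "C2 > 0"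
    and cone: "\<And>n z. norm z \<ge> R \<Longrightarrow> c * norm (g n z) * norm z \<le> g n z \<bullet> z"
    and growth: "\<And>n z. norm z \<ge> R \<Longrightarrow> norm (g n z) \<le> C2 * norm z"
    using coercive that by (rule uniform_outward_cone[of g])
  obtain C where C: "C > 0" "\<And>(z :: 'a ^ 'n) n m. norm (z $ n - z $ m) \<le> C * sqrt (dirichlet nb z)"
    using dirichlet_bounds_differences by metis
  have "\<exists>H. \<forall>z\<in>cball 0 R. norm (g n z) \<le> H" for n
  proof -
    have "bounded (g n ` cball 0 R)"
      by (intro compact_imp_bounded compact_continuous_image continuous_on_subset[OF cont]) auto
    then show ?thesis unfolding bounded_iff by blast
  qed
  then obtain H' where H': "\<And>n z. z \<in> cball 0 R \<Longrightarrow> norm (g n z) \<le> H' n" by metis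
  define H where "H = Max (range H')"
  have H: "norm (g n z) \<le> H" if "norm z \<le> R" for n z
  proof -
    have "norm (g n z) \<le> H' n" using that by (intro H') simp
    also have "\<dots> \<le> H" by (simp add: H_def)
    finally show ?thesis .
  qed
  have H0: "H \<ge> 0" using H[of 0 undefined] const(1) by (simp add: order_trans[OF norm_ge_zero])
  define N where "N = real CARD('n)"
  have N: "N > 0" by (simp add: N_def)
  \<comment> \<open>Bounds, per unit of step size, what an agent inside the ball can add:
    \<open>2 * H\<^sup>2\<close> from the squared step, as \<open>a k \<le> 1\<close>, and the rest
    from the inner product with a position of norm at most \<open>R + 1\<close>.\<close>
  define T where "T = 2 * H\<^sup>2 + 2 * ((R + 1) * H)"
  have T: "T \<ge> 0" using H0 const by (simp add: T_def)
  \<comment> \<open>Above \<open>N * (R + 2)\<^sup>2\<close> some agent must lie beyond radius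
    \<open>R + 2\<close>; below it, one step adds at most \<open>N * T\<close>.\<close>
  define \<rho> where "\<rho> = N * T + N * (R + 2)\<^sup>2"
  have NT: "0 < N * T + 1" using N T by (simp add: add_nonneg_pos)
  \<comment> \<open>Thresholds for \<open>a k\<close>, \<open>b k\<close>, \<open>a k / b k\<close>
    and \<open>norm (u k)\<close>. The shift \<open>u k\<close> uses up at most half of the cone
    margin, and \<open>a k * C2 \<le> c / 2\<close> lets the other half absorb the squared gradient
    step. The bound on \<open>b k\<close> reserves half of the Laplacian decrease, and the bound on
    the ratio makes this reserve exceed \<open>a k * (N * T)\<close>. The summand 1 keeps the
    denominator positive when \<open>T\<close> is 0.\<close>
  have "0 < min 1 (c / (2 * C2))" "0 < 1 / (4 * N)" "0 < 1 / (2 * C\<^sup>2 * (N * T + 1))" "0 < min 1 (c * R / 2)"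
    using const N C(1) NT by simp_all
  note ev = order_tendstoD(2)[OF lim(1) this(1)] order_tendstoD(2)[OF lim(2) this(2)]
    order_tendstoD(2)[OF lim(3) this(3)] order_tendstoD(2)[OF tendsto_norm_zero[OF u] this(4)]
  have "\<forall>\<^sub>F k in sequentially. (norm (y (Suc k)))\<^sup>2 \<le> max ((norm (y k))\<^sup>2) \<rho>"
    using ev
  proof eventually_elim
    case (elim k)
    let ?y = "y k" and ?x = "y k + u k" and ?a = "a k" and ?b = "b k"
    let ?L = "laplacian nb ?y" and ?D = "dirichlet nb ?y"
    let ?g = "\<lambda>n. g n (?x $ n)"
    let ?G = "(\<chi> n. ?g n) :: 'a ^ 'n"
    define t where "t n = 2 * ?a\<^sup>2 * (norm (?g n))\<^sup>2 - 2 * ?a * (?y $ n \<bullet> ?g n)" for n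
    have a: "?a > 0" "?a \<le> 1" "?a * C2 \<le> c / 2" using pos elim(1) const by (auto simp: field_simps)
    have b: "?b > 0" "2 * (?b * N) \<le> 1 / 2" using pos elim(2) N by (auto simp: field_simps)
    have un: "norm (u k $ n) \<le> 1" "norm (u k $ n) \<le> c * R / 2" for n
      using elim(4) Finite_Cartesian_Product.norm_nth_le[of "u k" n] by auto
    have far: "t n \<le> 0" if "norm (?x $ n) \<ge> R" for n
    proof -
      let ?p = "norm (?x $ n) * norm (?g n)"
      have "?y $ n \<bullet> ?g n = ?x $ n \<bullet> ?g n - u k $ n \<bullet> ?g n" by (simp add: inner_add_left)
      moreover have "?x $ n \<bullet> ?g n \<ge> c * ?p" using cone[OF that, of n] by (simp add: inner_commute mult_ac)
      moreover have "u k $ n \<bullet> ?g n \<le> (c / 2) * ?p"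
      proof -
        have "u k $ n \<bullet> ?g n \<le> norm (u k $ n) * norm (?g n)" by (rule norm_cauchy_schwarz)
        also have "\<dots> \<le> (c / 2 * norm (?x $ n)) * norm (?g n)"
          by (intro mult_right_mono order_trans[OF _ mult_left_mono[OF that]]) (use un(2)[of n] const in auto)
        finally show ?thesis by (simp add: mult_ac)
      qed
      ultimately have "?y $ n \<bullet> ?g n \<ge> (c / 2) * ?p" by simp
      moreover have "?a * (norm (?g n))\<^sup>2 \<le> (c / 2) * ?p"
      proof -
        have "?a * (norm (?g n))\<^sup>2 = ?a * norm (?g n) * norm (?g n)" by (simp add: power2_eq_square)
        also have "\<dots> \<le> ?a * norm (?g n) * (C2 * norm (?x $ n))"
          using growth[OF that, of n] a(1) by (intro mult_left_mono) auto
        also have "\<dots> = (?a * C2) * ?p" by simp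
        also have "\<dots> \<le> (c / 2) * ?p" using a(3) by (intro mult_right_mono) auto
        finally show ?thesis .
      qed
      ultimately have "2 * ?a * (?a * (norm (?g n))\<^sup>2 - ?y $ n \<bullet> ?g n) \<le> 0"
        using a(1) by (intro mult_nonneg_nonpos) auto
      then show ?thesis by (simp add: t_def power2_eq_square algebra_simps)
    qed
    have near: "norm (?y $ n) \<le> R + 1" if "norm (?x $ n) < R" for n
      using that un(1)[of n] norm_triangle_ineq4[of "?x $ n" "u k $ n"] by simp
    have t_le: "t n \<le> ?a * T" for n
    proof (cases "norm (?x $ n) \<ge> R")
      case True
      then have "t n \<le> 0" by (rule far)
      also have "0 \<le> ?a * T" using a(1) T by simp
      finally show ?thesis .
    next
      case False
      have gH: "norm (?g n) \<le> H" using H False by simp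
      have "?a * (norm (?g n))\<^sup>2 \<le> 1 * H\<^sup>2"
        using gH a by (intro mult_mono power_mono) auto
      moreover have "- (?y $ n \<bullet> ?g n) \<le> (R + 1) * H"
      proof -
        have "- (?y $ n \<bullet> ?g n) \<le> norm (?y $ n) * norm (?g n)"
          using Cauchy_Schwarz_ineq2[of "?y $ n" "?g n"] by linarith
        also have "\<dots> \<le> (R + 1) * H" using near[of n] False gH const(1) by (intro mult_mono) auto
        finally show ?thesis .
      qed
      ultimately have "?a * (2 * (?a * (norm (?g n))\<^sup>2) + 2 * (- (?y $ n \<bullet> ?g n))) \<le> ?a * T"
        using a(1) unfolding T_def by (intro mult_left_mono; linarith)
      then show ?thesis by (simp add: t_def power2_eq_square algebra_simps)
    qed
    \<comment> \<open>The cross term with the Laplacian is worth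
      \<open>b k * dirichlet nb (y k)\<close>. The parallelogram law decouples the squared step,
      whose Laplacian part consumes half of that; the gradient part goes into the
      \<open>t n\<close>.\<close>
    have main: "(norm (y (Suc k)))\<^sup>2 \<le> (norm ?y)\<^sup>2 - ?b / 2 * ?D + (\<Sum>n\<in>UNIV. t n)"
    proof -
      let ?B = "?b *\<^sub>R ?L" and ?A = "?a *\<^sub>R ?G"
      have expand: "(norm (p - q - s))\<^sup>2 = (norm p)\<^sup>2 - 2 * (p \<bullet> q) - 2 * (p \<bullet> s) + (norm (q + s))\<^sup>2"
        for p q s :: "'a ^ 'n"
        unfolding power2_norm_eq_inner by (simp add: inner_simps inner_commute)
      have parallelogram: "(norm (q + s))\<^sup>2 + (norm (q - s))\<^sup>2 = 2 * (norm q)\<^sup>2 + 2 * (norm s)\<^sup>2"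
        for q s :: "'a ^ 'n"
        unfolding power2_norm_eq_inner by (simp add: inner_simps inner_commute)
      have "(norm (?y - ?B - ?A))\<^sup>2 = (norm ?y)\<^sup>2 - 2 * (?y \<bullet> ?B) - 2 * (?y \<bullet> ?A) + (norm (?B + ?A))\<^sup>2"
        by (rule expand)
      moreover have "(norm (?B + ?A))\<^sup>2 \<le> 2 * (norm ?B)\<^sup>2 + 2 * (norm ?A)\<^sup>2"
        using parallelogram[of ?B ?A] zero_le_power2[of "norm (?B - ?A)"] by linarith
      moreover have "2 * (?y \<bullet> ?B) = ?b * ?D" using inner_laplacian[of ?y] by simp
      moreover have "2 * (norm ?B)\<^sup>2 \<le> ?b / 2 * ?D"
      proof -
        have "2 * (norm ?B)\<^sup>2 = 2 * ?b\<^sup>2 * (norm ?L)\<^sup>2" by (simp add: power_mult_distrib)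
        also have "\<dots> \<le> 2 * ?b\<^sup>2 * (N * ?D)"
          using norm_laplacian_le[of nb ?y] by (intro mult_left_mono) (auto simp: N_def)
        also have "\<dots> = (2 * (?b * N)) * (?b * ?D)" by (simp add: power2_eq_square)
        also have "\<dots> \<le> 1 / 2 * (?b * ?D)" using b by (intro mult_right_mono) (auto simp: dirichlet_nonneg)
        finally show ?thesis by simp
      qed
      moreover have "2 * (norm ?A)\<^sup>2 - 2 * (?y \<bullet> ?A) = (\<Sum>n\<in>UNIV. t n)"
      proof -
        have "(norm ?A)\<^sup>2 = ?a\<^sup>2 * (\<Sum>n\<in>UNIV. (norm (?g n))\<^sup>2)"
          by (simp add: power_mult_distrib norm_vec_power2)
        moreover have "?y \<bullet> ?A = ?a * (\<Sum>n\<in>UNIV. ?y $ n \<bullet> ?g n)" by (simp add: inner_vec_def sum_distrib_left)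
        ultimately show ?thesis
          by (simp add: t_def sum_subtractf sum_distrib_left mult.assoc)
      qed
      ultimately show ?thesis unfolding rec by linarith
    qed
    have bD: "0 \<le> ?b / 2 * ?D" using b(1) by (simp add: dirichlet_nonneg)
    show ?case
    proof (cases "\<forall>n. norm (?x $ n) \<ge> R")
      case True
      then have "(\<Sum>n\<in>UNIV. t n) \<le> 0" using far by (intro sum_nonpos) auto
      then show ?thesis using main bD by (intro max.coboundedI1) linarith
    next
      case False
      then obtain n where n: "norm (?x $ n) < R" by (auto simp: not_le)
      have "(\<Sum>n\<in>UNIV. t n) \<le> (\<Sum>n\<in>(UNIV::'n set). ?a * T)" using t_le by (intro sum_mono)
      then have sum_le: "(\<Sum>n\<in>UNIV. t n) \<le> ?a * (N * T)" by (simp add: N_def mult_ac)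
      show ?thesis
      proof (cases "(norm ?y)\<^sup>2 \<le> N * (R + 2)\<^sup>2")
        case True
        have "?a * (N * T) \<le> 1 * (N * T)" using a N T by (intro mult_right_mono) auto
        then have "(norm (y (Suc k)))\<^sup>2 \<le> \<rho>" using True main sum_le bD unfolding \<rho>_def by linarith
        then show ?thesis by (rule max.coboundedI2)
      next
        case False
        \<comment> \<open>Agent \<open>m\<close> is beyond \<open>R + 2\<close> and agent
          \<open>n\<close> within \<open>R + 1\<close>, so they differ by at least 1 and the energy
          is at least \<open>1 / C\<^sup>2\<close>, however large the configuration.\<close>
        have "\<exists>m. norm (?y $ m) > R + 2"
        proof (rule ccontr)
          assume "\<not> ?thesis"
          then have "(\<Sum>m\<in>UNIV. (norm (?y $ m))\<^sup>2) \<le> (\<Sum>m\<in>(UNIV::'n set). (R + 2)\<^sup>2)"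
            by (intro sum_mono power_mono) (auto simp: not_less)
          with False show False by (simp add: norm_vec_power2 N_def)
        qed
        then obtain m where "norm (?y $ m) > R + 2" ..
        then have "1 \<le> norm (?y $ m - ?y $ n)"
          using near[OF n] norm_triangle_ineq2[of "?y $ m" "?y $ n"] by linarith
        also have "\<dots> \<le> C * sqrt ?D" by (rule C(2))
        finally have "1\<^sup>2 \<le> (C * sqrt ?D)\<^sup>2" by (intro power_mono) auto
        then have CD: "1 \<le> C\<^sup>2 * ?D" by (simp add: power_mult_distrib dirichlet_nonneg)
        have "?a * (N * T) \<le> ?a * (N * T + 1)" using a by simp
        also have "\<dots> = (?a / ?b) * (?b * (N * T + 1))" using b(1) by simp
        also have "\<dots> \<le> (1 / (2 * C\<^sup>2 * (N * T + 1))) * (?b * (N * T + 1))"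
          using elim(3) b(1) N T by (intro mult_right_mono) auto
        also have "\<dots> = ?b / (2 * C\<^sup>2)"
        proof -
          show ?thesis using NT by simp
        qed
        also have "\<dots> \<le> ?b / (2 * C\<^sup>2) * (C\<^sup>2 * ?D)"
          using mult_left_mono[OF CD, of "?b / (2 * C\<^sup>2)"] b(1) by simp
        also have "\<dots> = ?b / 2 * ?D" using C(1) by simp
        finally have "(norm (y (Suc k)))\<^sup>2 \<le> (norm ?y)\<^sup>2" using main sum_le by linarith
        then show ?thesis by (rule max.coboundedI1)
      qed
    qed
  qed
  then show ?thesis by (rule bounded_if_eventually_decreasing_beyond)
qed

section \<open>Consensus, noise filter and descent of the mean\<close>

lemma linear_deviation: "linear (\<lambda>z :: 'a::real_inner ^ 'n. z - (\<chi> n. vmean z))"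
proof (rule linearI)
  interpret v: linear "vmean :: 'a ^ 'n \<Rightarrow> 'a" by (rule linear_vmean)
  show "z + w - (\<chi> n. vmean (z + w)) = z - (\<chi> n. vmean z) + (w - (\<chi> n. vmean w))" for z w :: "'a ^ 'n"
    by (simp add: v.add vec_eq_iff)
  show "c *\<^sub>R z - (\<chi> n. vmean (c *\<^sub>R z)) = c *\<^sub>R (z - (\<chi> n. vmean z))" for c and z :: "'a ^ 'n"
    by (simp add: v.scale vec_eq_iff algebra_simps)
qed

text \<open>On the mean-zero subspace the contraction rate is proportional to \<open>b k\<close>,
  and so is the perturbation. This serves twice: for the correction inside the noise filter and for
  the deviation of the agents from their mean.\<close>

lemma consensus_of_mean_zero:
  fixes q s :: "nat \<Rightarrow> 'a::euclidean_space ^ 'n"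
  assumes rec: "\<And>k. q (Suc k) = q k - b k *\<^sub>R laplacian nb (q k) - b k *\<^sub>R s k"
    and mean: "\<And>k. vmean (q k) = 0" and b: "\<And>k. 0 < b k" "b \<longlonglongrightarrow> 0" "\<not> summable b"
    and s: "s \<longlonglongrightarrow> 0"
  shows "q \<longlonglongrightarrow> 0"
proof -
  obtain c b0 where c: "c > 0" "b0 > 0" and contr: "\<And>(z :: 'a ^ 'n) t. vmean z = 0 \<Longrightarrow> 0 \<le> t \<Longrightarrow> t \<le> b0 \<Longrightarrow>
      norm (z - t *\<^sub>R laplacian nb z) \<le> (1 - c * t) * norm z"
    using laplacian_contraction by metis
  have "(\<lambda>k. norm (q k)) \<longlonglongrightarrow> 0"
  proof (rule contraction_tendsto_0_eventually[where b = "\<lambda>k. c * b k" and e = "\<lambda>k. norm (s k) / c"])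
    have "\<forall>\<^sub>F k in sequentially. b k < b0" using b(2) c(2) by (rule order_tendstoD)
    then show "\<forall>\<^sub>F k in sequentially. norm (q (Suc k)) \<le> (1 - c * b k) * norm (q k) + c * b k * (norm (s k) / c)"
    proof eventually_elim
      case (elim k)
      have "norm (q (Suc k)) \<le> norm (q k - b k *\<^sub>R laplacian nb (q k)) + norm (b k *\<^sub>R s k)"
        unfolding rec by (rule norm_triangle_ineq4)
      also have "\<dots> \<le> (1 - c * b k) * norm (q k) + b k * norm (s k)"
        using contr[OF mean, of "b k" k] b(1)[of k] elim by simp
      finally show ?case using c(1) by simp
    qed
    show "\<forall>\<^sub>F k in sequentially. c * b k \<le> 1"
      using order_tendstoD(2)[OF b(2), of "1 / c"] c(1)
      by (auto simp: field_simps elim: eventually_mono)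
    show "\<not> summable (\<lambda>k. c * b k)" using b(3) c(1) by (simp add: summable_cmult_iff)
    show "(\<lambda>k. norm (s k) / c) \<longlonglongrightarrow> 0" using tendsto_divide_zero[OF tendsto_norm_zero[OF s]] .
  qed (use b c in \<open>auto intro!: always_eventually simp: less_imp_le\<close>)
  then show ?thesis by (simp add: tendsto_norm_zero_iff)
qed

text \<open>The noise alone, filtered by the consensus operator: the tail sums of the noise plus a
  mean-zero correction that the Laplacian contracts.\<close>

lemma filtered_noise:
  fixes w :: "nat \<Rightarrow> 'a::euclidean_space ^ 'n"
  assumes w: "summable w" and b: "\<And>k. 0 < b k" "b \<longlonglongrightarrow> 0" "\<not> summable b"
  shows "\<exists>u. (\<forall>k. u (Suc k) = u k - b k *\<^sub>R laplacian nb (u k) - w k) \<and> u \<longlonglongrightarrow> 0"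
proof -
  interpret L: linear "laplacian nb :: 'a ^ 'n \<Rightarrow> 'a ^ 'n" by (rule linear_laplacian)
  interpret v: linear "vmean :: 'a ^ 'n \<Rightarrow> 'a" by (rule linear_vmean)
  define r where "r k = (\<Sum>j. w (j + k))" for k
  have r_Suc: "r (Suc k) = r k - w k" for k
    using suminf_split_head[of "\<lambda>j. w (j + k)"] w by (simp add: r_def summable_iff_shift)
  have r: "r \<longlonglongrightarrow> 0" unfolding r_def by (rule suminf_exist_split2[OF w])
  \<comment> \<open>The tail \<open>r\<close> accounts for \<open>- w k\<close> but lacks its
    Laplacian term, so \<open>q\<close> is driven by precisely that term. It has mean 0, hence
    \<open>q\<close> stays in the subspace where the Laplacian contracts.\<close>
  define q where "q = rec_nat (0 :: 'a ^ 'n) (\<lambda>k z. z - b k *\<^sub>R laplacian nb z - b k *\<^sub>R laplacian nb (r k))"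
  have q: "q 0 = 0" "q (Suc k) = q k - b k *\<^sub>R laplacian nb (q k) - b k *\<^sub>R laplacian nb (r k)" for k
    by (simp_all add: q_def)
  have q_mean: "vmean (q k) = 0" for k
    by (induction k) (simp_all add: q v.diff v.scale v.zero vmean_laplacian)
  have Lr: "(\<lambda>k. laplacian nb (r k)) \<longlonglongrightarrow> 0"
    using L.linear_axioms r
    unfolding linear_conv_bounded_linear by (rule bounded_linear.tendsto_zero)
  have "q \<longlonglongrightarrow> 0" by (rule consensus_of_mean_zero[OF q(2) q_mean b Lr])
  with r have "(\<lambda>k. r k + q k) \<longlonglongrightarrow> 0" by (rule tendsto_add_zero)
  moreover have "r (Suc k) + q (Suc k) = r k + q k - b k *\<^sub>R laplacian nb (r k + q k) - w k" for k
    by (simp add: r_Suc q L.add algebra_simps)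
  ultimately show ?thesis by (intro exI[of _ "\<lambda>k. r k + q k"]) simp
qed

text \<open>Randomness has been reduced to \<open>summable w\<close>. Two linear maps split the
  dynamics: the deviation from the mean, on which the Laplacian acts, and the mean, which the
  Laplacian leaves alone.\<close>

lemma consensus_descent_converges:
  fixes f :: "'n \<Rightarrow> 'a::euclidean_space \<Rightarrow> real" and g :: "'n \<Rightarrow> 'a \<Rightarrow> 'a"
    and x w :: "nat \<Rightarrow> 'a ^ 'n"
  assumes deriv: "\<And>n z. GDERIV (f n) z :> g n z"
    and cont: "\<And>n. continuous_on UNIV (g n)"
    and coercive: "\<And>n. \<exists>R>0. \<exists>C1>0. \<exists>C2>0. \<forall>y. norm y \<ge> R \<longrightarrow>
      (g n y /\<^sub>R norm (g n y)) \<bullet> (y /\<^sub>R norm y) \<ge> C1 \<and> norm (g n y) \<le> C2 * norm y"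
    and rec: "\<And>k. x (Suc k) = x k - b k *\<^sub>R laplacian nb (x k) - a k *\<^sub>R (\<chi> n. g n (x k $ n)) - w k"
    and pos: "\<And>k. 0 < a k" "\<And>k. 0 < b k"
    and lim: "a \<longlonglongrightarrow> 0" "b \<longlonglongrightarrow> 0" "(\<lambda>k. a k / b k) \<longlonglongrightarrow> 0"
    and nsum: "\<not> summable a" "\<not> summable b" and w: "summable w"
    and dense: "closure (UNIV - (\<lambda>z. \<Sum>n\<in>UNIV. f n z) ` {z. (\<Sum>n\<in>UNIV. g n z) = 0}) = (UNIV :: real set)"
  shows "(\<lambda>k. norm (x k $ n - x k $ l)) \<longlonglongrightarrow> 0"
    and "converges_to_set (\<lambda>k. x k $ n) {z. (\<Sum>n\<in>UNIV. g n z) = 0}"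
proof -
  interpret L: linear "laplacian nb :: 'a ^ 'n \<Rightarrow> 'a ^ 'n" by (rule linear_laplacian)
  interpret v: linear "vmean :: 'a ^ 'n \<Rightarrow> 'a" by (rule linear_vmean)
  define P where "P z = z - (\<chi> n. vmean z)" for z :: "'a ^ 'n"
  interpret P: linear P unfolding P_def by (rule linear_deviation)
  have LP: "laplacian nb (P z) = laplacian nb z" for z by (simp add: P_def L.diff)
  have PL: "P (laplacian nb z) = laplacian nb z" for z :: "'a ^ 'n"
    by (simp add: P_def vmean_laplacian vec_eq_iff)
  have vP: "vmean (P z) = 0" for z by (simp add: P_def v.diff)
  define G where "G z = (\<chi> n. g n (z $ n))" for z :: "'a ^ 'n"
  obtain u where u_Suc: "\<And>k. u (Suc k) = u k - b k *\<^sub>R laplacian nb (u k) - w k" and u: "u \<longlonglongrightarrow> 0"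
    using filtered_noise[OF w pos(2) lim(2) nsum(2)] by blast
  define y where "y k = x k - u k" for k
  have xy: "x k = y k + u k" for k by (simp add: y_def)
  have y_Suc: "y (Suc k) = y k - b k *\<^sub>R laplacian nb (y k) - a k *\<^sub>R G (x k)" for k
    by (simp add: y_def rec u_Suc L.diff G_def algebra_simps)
  have y_bdd: "bounded (range y)"
  proof (rule perturbed_consensus_descent_bounded[of g, OF cont coercive _ pos lim u])
    show "y (Suc k) = y k - b k *\<^sub>R laplacian nb (y k) - a k *\<^sub>R (\<chi> n. g n ((y k + u k) $ n))" for k
      using y_Suc[of k] by (simp only: G_def xy)
  qed
  have "bounded (range u)" using u by (metis Bseq_eq_bounded convergentI convergent_imp_Bseq)
  then have x_bdd: "bounded (range x)" using bounded_plus_comp[OF y_bdd] by (simp add: xy[abs_def])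
  have contG: "continuous_on UNIV G"
    unfolding G_def
    by (intro continuous_on_vec_lambda continuous_on_compose2[OF cont] continuous_on_component continuous_on_id) auto
  have "bounded (G ` closure (range x))"
    using x_bdd
    by (intro compact_imp_bounded compact_continuous_image continuous_on_subset[OF contG])
       (auto simp: compact_closure)
  then have GX: "bounded (range (\<lambda>k. G (x k)))"
    by (rule bounded_subset) (use closure_subset in fastforce)
  have consensus: "(\<lambda>k. P (y k)) \<longlonglongrightarrow> 0"
  proof (rule consensus_of_mean_zero[OF _ vP pos(2) lim(2) nsum(2)])
    \<comment> \<open>Factoring \<open>a k\<close> as \<open>b k * (a k / b k)\<close> exhibits the
      gradient term as \<open>b k\<close> times a null sequence, because \<open>G\<close> is bounded
      along the orbit.\<close>
    show "P (y (Suc k)) = P (y k) - b k *\<^sub>R laplacian nb (P (y k)) - b k *\<^sub>R ((a k / b k) *\<^sub>R P (G (x k)))" for k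
      using pos(2)[of k] by (simp add: y_Suc P.diff P.scale LP PL)
    have "bounded (P ` range (\<lambda>k. G (x k)))"
      using bounded_linear_image[OF GX] P.linear_axioms by (simp add: linear_conv_bounded_linear)
    then have "Bseq (\<lambda>k. P (G (x k)))" by (simp add: Bseq_eq_bounded image_image)
    moreover have "Zfun (\<lambda>k. a k / b k) sequentially" using lim(3) by (simp add: tendsto_Zfun_iff)
    ultimately have "Zfun (\<lambda>k. (a k / b k) *\<^sub>R P (G (x k))) sequentially"
      by (rule bounded_bilinear.Zfun_prod_Bfun[OF bounded_bilinear_scaleR, rotated])
    then show "(\<lambda>k. (a k / b k) *\<^sub>R P (G (x k))) \<longlonglongrightarrow> 0" by (simp add: tendsto_Zfun_iff)
  qed
  define m where "m k = vmean (y k)" for k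
  have xm: "(\<lambda>k. x k $ n - m k) \<longlonglongrightarrow> 0" for n
  proof -
    have "(\<lambda>k. (P (y k) + u k) $ n) \<longlonglongrightarrow> (0 :: 'a ^ 'n) $ n"
      by (intro tendsto_vec_nth tendsto_add_zero consensus u)
    then show ?thesis by (simp add: P_def xy m_def algebra_simps)
  qed
  show "(\<lambda>k. norm (x k $ n - x k $ l)) \<longlonglongrightarrow> 0" for n l
    using tendsto_norm_zero[OF tendsto_diff[OF xm[of n] xm[of l], simplified]] by simp
  have m_bdd: "bounded (range m)"
  proof -
    obtain B where "\<And>k. norm (y k) \<le> B" using y_bdd by (auto simp: bounded_iff)
    then have "norm (m k) \<le> B" for k unfolding m_def using norm_vmean_le order_trans by blast
    then show ?thesis by (auto simp: bounded_iff)
  qed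
  define h where "h z = (\<Sum>n\<in>UNIV. g n z)" for z
  \<comment> \<open>The price of evaluating each gradient at its agent instead of at the mean. With
    it, \<open>m\<close> performs gradient descent for the whole sum with step size
    \<open>a k / real CARD('n)\<close>.\<close>
  define e where "e k = (\<Sum>n\<in>UNIV. g n (x k $ n) - g n (m k))" for k
  have conth: "continuous_on UNIV h" unfolding h_def by (intro continuous_on_sum cont)
  have e: "e \<longlonglongrightarrow> 0"
    unfolding e_def
  proof (rule tendsto_null_sum)
    fix n
    have "bounded (range (\<lambda>k. x k $ n))"
    proof -
      obtain B where "\<And>k. norm (x k) \<le> B" using x_bdd by (auto simp: bounded_iff)
      then have "norm (x k $ n) \<le> B" for k
        using Finite_Cartesian_Product.norm_nth_le order_trans by blast
      then show ?thesis by (auto simp: bounded_iff)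
    qed
    then show "(\<lambda>k. g n (x k $ n) - g n (m k)) \<longlonglongrightarrow> 0"
      by (rule continuous_diff_tendsto_0[OF cont _ m_bdd xm])
  qed
  let ?N = "real CARD('n)"
  have hm: "(\<lambda>k. h (m k)) \<longlonglongrightarrow> 0"
  proof (rule perturbed_gradient_descent[OF _ conth m_bdd _ _ _ _ e])
    show "GDERIV (\<lambda>z. \<Sum>n\<in>UNIV. f n z) z :> h z" for z
      unfolding h_def by (intro gderiv_sum deriv)
    show "m (Suc k) = m k - (a k / ?N) *\<^sub>R (h (m k) + e k)" for k
    proof -
      have "h (m k) + e k = (\<Sum>n\<in>UNIV. g n (x k $ n))" by (simp add: h_def e_def sum_subtractf)
      then show ?thesis
        by (simp add: m_def y_Suc v.diff v.scale vmean_laplacian) (simp add: vmean_def G_def divide_inverse_commute)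
    qed
    show "0 \<le> a k / ?N" for k using pos(1)[of k] by simp
    show "(\<lambda>k. a k / ?N) \<longlonglongrightarrow> 0" using lim(1) by (rule tendsto_divide_zero)
    show "\<not> summable (\<lambda>k. a k / ?N)" using nsum(1) by (simp add: summable_divide_iff)
    show "closure (UNIV - (\<lambda>z. \<Sum>n\<in>UNIV. f n z) ` {z. h z = 0}) = UNIV" using dense by (simp add: h_def)
  qed
  have "converges_to_set m {z. h z = 0}" using m_bdd conth hm by (rule converges_to_zero_set)
  then show "converges_to_set (\<lambda>k. x k $ n) {z. (\<Sum>n\<in>UNIV. g n z) = 0}" for n
    unfolding h_def
    by (rule converges_to_set_close) (use tendsto_norm_zero[OF xm[of n]] in \<open>simp add: dist_norm\<close>)
qed

end

section \<open>Square-integrable martingale differences\<close>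

context prob_space
begin

lemma integrable_mult_of_square_integrable:
  fixes Y Z :: "'a \<Rightarrow> real"
  assumes [measurable]: "Y \<in> borel_measurable M" "Z \<in> borel_measurable M"
    and "integrable M (\<lambda>\<omega>. (Y \<omega>)\<^sup>2)" "integrable M (\<lambda>\<omega>. (Z \<omega>)\<^sup>2)"
  shows "integrable M (\<lambda>\<omega>. Y \<omega> * Z \<omega>)"
proof (rule Bochner_Integration.integrable_bound)
  show "integrable M (\<lambda>\<omega>. (Y \<omega>)\<^sup>2 + (Z \<omega>)\<^sup>2)" using assms by simp
  have "\<bar>y * z\<bar> \<le> y\<^sup>2 + z\<^sup>2" for y z :: real
    using sum_squares_bound[of "\<bar>y\<bar>" "\<bar>z\<bar>"] mult_nonneg_nonneg[OF abs_ge_zero abs_ge_zero, of y z]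
    unfolding abs_mult power2_abs by linarith
  then show "AE \<omega> in M. norm (Y \<omega> * Z \<omega>) \<le> norm ((Y \<omega>)\<^sup>2 + (Z \<omega>)\<^sup>2)"
    by (intro always_eventually) auto
qed simp

lemma orthogonal_if_cond_exp_0:
  fixes X Y :: "'a \<Rightarrow> real"
  assumes sub: "subalgebra M A" and Y: "Y \<in> borel_measurable A" and X: "X \<in> borel_measurable M"
    and sq: "integrable M (\<lambda>\<omega>. (Y \<omega>)\<^sup>2)" "integrable M (\<lambda>\<omega>. (X \<omega>)\<^sup>2)"
    and mean: "AE \<omega> in M. real_cond_exp M A X \<omega> = 0"
  shows "expectation (\<lambda>\<omega>. Y \<omega> * X \<omega>) = 0"
proof -
  interpret finite_measure_subalgebra M A by unfold_locales (rule sub)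
  interpret sigma_finite_subalgebra M A
    by (rule finite_measure_subalgebra_is_sigma_finite) (rule finite_measure_subalgebra_axioms)
  have [measurable]: "Y \<in> borel_measurable M" using sub Y by (rule measurable_from_subalg)
  have [measurable]: "X \<in> borel_measurable M" by (rule X)
  have [measurable]: "real_cond_exp M A X \<in> borel_measurable M"
    by (rule measurable_from_subalg[OF sub borel_measurable_cond_exp])
  have "integrable M (\<lambda>\<omega>. Y \<omega> * X \<omega>)"
    by (rule integrable_mult_of_square_integrable) (simp_all add: sq)
  from real_cond_exp_intg(2)[OF this Y X]
  have "expectation (\<lambda>\<omega>. Y \<omega> * X \<omega>) = expectation (\<lambda>\<omega>. Y \<omega> * real_cond_exp M A X \<omega>)" ..
  also have "\<dots> = expectation (\<lambda>\<omega>. 0)"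
  proof (rule integral_cong_AE)
    show "AE \<omega> in M. Y \<omega> * real_cond_exp M A X \<omega> = 0" using mean by eventually_elim simp
  qed simp_all
  finally show ?thesis by simp
qed

end

text \<open>The indexing is shifted: \<open>X k\<close> is the increment from time \<open>k\<close>
  to \<open>Suc k\<close>, known at \<open>Suc k\<close> and centred given
  \<open>F k\<close>.\<close>

locale martingale_differences = prob_space +
  fixes X :: "nat \<Rightarrow> 'a \<Rightarrow> real" and F :: "nat \<Rightarrow> 'a measure"
  assumes sub: "subalgebra M (F k)" and filtration: "sets (F k) \<subseteq> sets (F (Suc k))"
    and adapted: "X k \<in> borel_measurable (F (Suc k))"
    and square_integrable: "integrable M (\<lambda>\<omega>. (X k \<omega>)\<^sup>2)"
    and mean_0: "AE \<omega> in M. real_cond_exp M (F k) (X k) \<omega> = 0"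
begin

lemma filtration_mono: "j \<le> k \<Longrightarrow> sets (F j) \<subseteq> sets (F k)"
  by (rule lift_Suc_mono_le[of "\<lambda>k. sets (F k)"]) (use filtration in auto)

lemma space_F [simp]: "space (F k) = space M"
  using sub by (simp add: subalgebra_def)

lemma adapted_mono: "j < k \<Longrightarrow> X j \<in> borel_measurable (F k)"
  using adapted[of j] filtration_mono[of "Suc j" k] by (auto simp: measurable_def)

lemma X_measurable [measurable]: "X k \<in> borel_measurable M"
  by (rule measurable_from_subalg[OF sub adapted])

definition S :: "nat \<Rightarrow> nat \<Rightarrow> 'a \<Rightarrow> real" where
  "S m n \<omega> = (\<Sum>i<n. X (m + i) \<omega>)"

text \<open>The partial sums frozen when their modulus first reaches \<open>r\<close>, written with
  a predictable 0-1 factor: the factor of \<open>X (m + i)\<close> depends only on earlier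
  increments.\<close>

definition stopped :: "nat \<Rightarrow> real \<Rightarrow> nat \<Rightarrow> 'a \<Rightarrow> real" where
  "stopped m r n \<omega> = (\<Sum>i<n. X (m + i) \<omega> * of_bool (\<forall>j\<le>i. \<bar>S m j \<omega>\<bar> < r))"

lemma S_measurable_F: "n \<le> k \<Longrightarrow> S m n \<in> borel_measurable (F (m + k))"
  unfolding S_def[abs_def] by (intro borel_measurable_sum adapted_mono) auto

lemma S_measurable [measurable]: "S m n \<in> borel_measurable M"
  unfolding S_def[abs_def] by measurable

lemma continue_measurable_F: "i \<le> k \<Longrightarrow> (\<lambda>\<omega>. of_bool (\<forall>j\<le>i. \<bar>S m j \<omega>\<bar> < r) :: real) \<in> borel_measurable (F (m + k))"
proof -
  assume "i \<le> k"
  let ?A = "{\<omega> \<in> space (F (m + k)). \<forall>j\<in>{..i}. \<bar>S m j \<omega>\<bar> < r}"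
  have "?A \<in> sets (F (m + k))"
  proof (rule sets.sets_Collect_finite_All)
    fix j assume "j \<in> {..i}"
    then have [measurable]: "S m j \<in> borel_measurable (F (m + k))"
      using \<open>i \<le> k\<close> by (intro S_measurable_F) simp
    show "{\<omega> \<in> space (F (m + k)). \<bar>S m j \<omega>\<bar> < r} \<in> sets (F (m + k))" by measurable
  qed simp
  then have "(indicator ?A :: 'a \<Rightarrow> real) \<in> borel_measurable (F (m + k))"
    by (rule borel_measurable_indicator)
  then show ?thesis
    by (rule measurable_cong[THEN iffD1, rotated]) (auto simp: indicator_def)
qed

lemma stopped_measurable_F: "stopped m r n \<in> borel_measurable (F (m + n))"
  unfolding stopped_def[abs_def]
  by (intro borel_measurable_sum borel_measurable_times adapted_mono continue_measurable_F) auto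

text \<open>Predictability makes each new increment orthogonal to the sum so far, so second moments
  add, and the 0-1 factors only shrink them. Integrability is carried through the same induction
  since the cross term needs it.\<close>

lemma stopped_second_moment:
  "integrable M (\<lambda>\<omega>. (stopped m r n \<omega>)\<^sup>2) \<and>
   expectation (\<lambda>\<omega>. (stopped m r n \<omega>)\<^sup>2) \<le> (\<Sum>i<n. expectation (\<lambda>\<omega>. (X (m + i) \<omega>)\<^sup>2))"
proof (induction n)
  case 0
  show ?case by (simp add: stopped_def)
next
  case (Suc n)
  define I where "I \<omega> = (of_bool (\<forall>j\<le>n. \<bar>S m j \<omega>\<bar> < r) :: real)" for \<omega>
  define Z where "Z = stopped m r n"
  have I01: "I \<omega> = 0 \<or> I \<omega> = 1" for \<omega> unfolding I_def of_bool_def by presburger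
  have I_F: "I \<in> borel_measurable (F (m + n))"
    unfolding I_def[abs_def] by (rule continue_measurable_F) simp
  have Z_F: "Z \<in> borel_measurable (F (m + n))" unfolding Z_def by (rule stopped_measurable_F)
  have [measurable]: "I \<in> borel_measurable M" "Z \<in> borel_measurable M"
    by (rule measurable_from_subalg[OF sub I_F], rule measurable_from_subalg[OF sub Z_F])
  have Z2: "integrable M (\<lambda>\<omega>. (Z \<omega>)\<^sup>2)" using Suc by (simp add: Z_def)
  have ZI2: "integrable M (\<lambda>\<omega>. (Z \<omega> * I \<omega>)\<^sup>2)"
  proof (rule Bochner_Integration.integrable_bound[OF Z2])
    show "AE \<omega> in M. norm ((Z \<omega> * I \<omega>)\<^sup>2) \<le> norm ((Z \<omega>)\<^sup>2)"
    proof (rule AE_I2)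
      show "norm ((Z \<omega> * I \<omega>)\<^sup>2) \<le> norm ((Z \<omega>)\<^sup>2)" for \<omega> using I01[of \<omega>] by auto
    qed
  qed simp
  have XI2: "integrable M (\<lambda>\<omega>. (X (m + n) \<omega> * I \<omega>)\<^sup>2)"
  proof (rule Bochner_Integration.integrable_bound[OF square_integrable])
    show "AE \<omega> in M. norm ((X (m + n) \<omega> * I \<omega>)\<^sup>2) \<le> norm ((X (m + n) \<omega>)\<^sup>2)"
    proof (rule AE_I2)
      show "norm ((X (m + n) \<omega> * I \<omega>)\<^sup>2) \<le> norm ((X (m + n) \<omega>)\<^sup>2)" for \<omega> using I01[of \<omega>] by auto
    qed
  qed simp
  have ZIX: "integrable M (\<lambda>\<omega>. (Z \<omega> * I \<omega>) * X (m + n) \<omega>)"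
    by (rule integrable_mult_of_square_integrable[OF _ _ ZI2 square_integrable]) simp_all
  have "expectation (\<lambda>\<omega>. (Z \<omega> * I \<omega>) * X (m + n) \<omega>) = 0"
    using Z_F I_F
    by (intro orthogonal_if_cond_exp_0[OF sub _ X_measurable ZI2 square_integrable mean_0] borel_measurable_times)
  moreover have "expectation (\<lambda>\<omega>. (X (m + n) \<omega> * I \<omega>)\<^sup>2) \<le> expectation (\<lambda>\<omega>. (X (m + n) \<omega>)\<^sup>2)"
  proof (rule integral_mono[OF XI2 square_integrable])
    show "(X (m + n) \<omega> * I \<omega>)\<^sup>2 \<le> (X (m + n) \<omega>)\<^sup>2" for \<omega> using I01[of \<omega>] by auto
  qed
  moreover have expand: "(stopped m r (Suc n) \<omega>)\<^sup>2
      = (Z \<omega>)\<^sup>2 + 2 * ((Z \<omega> * I \<omega>) * X (m + n) \<omega>) + (X (m + n) \<omega> * I \<omega>)\<^sup>2" for \<omega>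
    by (simp add: stopped_def Z_def I_def power2_eq_square algebra_simps del: of_bool_eq_1_iff)
  ultimately show ?case
    using Suc Z2 ZIX XI2 unfolding expand Z_def[symmetric] by simp
qed

lemma stopped_exceeds:
  assumes "k \<le> n" "r \<le> \<bar>S m k \<omega>\<bar>"
  shows "r \<le> \<bar>stopped m r n \<omega>\<bar>"
proof -
  define l where "l = (LEAST k. r \<le> \<bar>S m k \<omega>\<bar>)"
  have l: "r \<le> \<bar>S m l \<omega>\<bar>" unfolding l_def by (rule LeastI[of _ k]) (rule assms)
  have "l \<le> n" unfolding l_def using assms Least_le[of "\<lambda>k. r \<le> \<bar>S m k \<omega>\<bar>" k] by simp
  have before: "\<bar>S m j \<omega>\<bar> < r" if "j < l" for j
    using not_less_Least[of j "\<lambda>k. r \<le> \<bar>S m k \<omega>\<bar>"] that by (simp add: l_def)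
  have "stopped m r n \<omega> = (\<Sum>i<l. X (m + i) \<omega> * of_bool (\<forall>j\<le>i. \<bar>S m j \<omega>\<bar> < r))"
    unfolding stopped_def
  proof (rule sum.mono_neutral_right)
    show "\<forall>i\<in>{..<n} - {..<l}. X (m + i) \<omega> * of_bool (\<forall>j\<le>i. \<bar>S m j \<omega>\<bar> < r) = 0"
    proof
      fix i assume "i \<in> {..<n} - {..<l}"
      then have "l \<le> i" by simp
      then have "\<not> (\<forall>j\<le>i. \<bar>S m j \<omega>\<bar> < r)" using l by (meson not_le)
      then show "X (m + i) \<omega> * of_bool (\<forall>j\<le>i. \<bar>S m j \<omega>\<bar> < r) = 0" by simp
    qed
  qed (use \<open>l \<le> n\<close> in auto)
  also have "\<dots> = S m l \<omega>"
    unfolding S_def[of m l]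
  proof (rule sum.cong)
    fix i assume "i \<in> {..<l}"
    then have "\<forall>j\<le>i. \<bar>S m j \<omega>\<bar> < r" using before by auto
    then show "X (m + i) \<omega> * of_bool (\<forall>j\<le>i. \<bar>S m j \<omega>\<bar> < r) = X (m + i) \<omega>" by simp
  qed simp
  finally show ?thesis using l by simp
qed

text \<open>Kolmogorov's inequality: a path that ever reaches \<open>r\<close> remains frozen at
  such a value, so Markov's inequality at the final time covers all earlier ones.\<close>

lemma maximal_inequality:
  assumes r: "r > 0"
  shows "prob {\<omega> \<in> space M. \<exists>k\<le>n. r \<le> \<bar>S m k \<omega>\<bar>} \<le> (\<Sum>i<n. expectation (\<lambda>\<omega>. (X (m + i) \<omega>)\<^sup>2)) / r\<^sup>2"
proof -
  have [measurable]: "stopped m r n \<in> borel_measurable M"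
    by (rule measurable_from_subalg[OF sub stopped_measurable_F])
  have "prob {\<omega> \<in> space M. \<exists>k\<le>n. r \<le> \<bar>S m k \<omega>\<bar>} \<le> prob {\<omega> \<in> space M. r\<^sup>2 \<le> (stopped m r n \<omega>)\<^sup>2}"
  proof (rule finite_measure_mono)
    show "{\<omega> \<in> space M. \<exists>k\<le>n. r \<le> \<bar>S m k \<omega>\<bar>} \<subseteq> {\<omega> \<in> space M. r\<^sup>2 \<le> (stopped m r n \<omega>)\<^sup>2}"
      using stopped_exceeds r by (fastforce simp: abs_le_square_iff[symmetric])
  qed simp
  also have "\<dots> \<le> expectation (\<lambda>\<omega>. (stopped m r n \<omega>)\<^sup>2) / r\<^sup>2"
    using stopped_second_moment r by (intro integral_Markov_inequality_measure[where A = "{}"]) auto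
  also have "\<dots> \<le> (\<Sum>i<n. expectation (\<lambda>\<omega>. (X (m + i) \<omega>)\<^sup>2)) / r\<^sup>2"
    using stopped_second_moment by (intro divide_right_mono) auto
  finally show ?thesis .
qed

text \<open>The probability that the sums started at \<open>m\<close> ever reach \<open>r\<close> is
  at most a tail of the variance series divided by \<open>r\<^sup>2\<close>. Letting
  \<open>m\<close> grow, almost surely some start never does; taking \<open>r\<close> from a null
  sequence gives the Cauchy criterion.\<close>

lemma AE_summable:
  assumes summ: "summable (\<lambda>k. expectation (\<lambda>\<omega>. (X k \<omega>)\<^sup>2))"
  shows "AE \<omega> in M. summable (\<lambda>k. X k \<omega>)"
proof -
  define v where "v k = expectation (\<lambda>\<omega>. (X k \<omega>)\<^sup>2)" for k
  define tail where "tail m = (\<Sum>i. v (i + m))" for m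
  have v: "summable v" "\<And>k. 0 \<le> v k" using summ by (simp_all add: v_def[abs_def])
  have tail: "tail \<longlonglongrightarrow> 0" unfolding tail_def by (rule suminf_exist_split2[OF v(1)])
  have tail_le: "(\<Sum>i<n. v (m + i)) \<le> tail m" for m n
    unfolding tail_def add.commute[of m] using v by (intro sum_le_suminf) (auto simp: summable_iff_shift)
  define D where "D m r = {\<omega> \<in> space M. \<exists>k. r \<le> \<bar>S m k \<omega>\<bar>}" for m and r :: real
  have D_meas [measurable]: "D m r \<in> sets M" for m r unfolding D_def by measurable
  have D_le: "prob (D m r) \<le> tail m / r\<^sup>2" if "r > 0" for m r
  proof -
    let ?E = "\<lambda>n. {\<omega> \<in> space M. \<exists>k\<le>n. r \<le> \<bar>S m k \<omega>\<bar>}"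
    have conv: "(\<lambda>n. prob (?E n)) \<longlonglongrightarrow> prob (\<Union>n. ?E n)"
      by (rule finite_Lim_measure_incseq) (auto simp: incseq_def intro: order_trans)
    have Un: "(\<Union>n. ?E n) = D m r" by (auto simp: D_def)
    have "prob (?E n) \<le> tail m / r\<^sup>2" for n
    proof -
      have "prob (?E n) \<le> (\<Sum>i<n. v (m + i)) / r\<^sup>2"
        unfolding v_def by (rule maximal_inequality[OF that])
      also have "\<dots> \<le> tail m / r\<^sup>2" by (intro divide_right_mono tail_le) simp
      finally show ?thesis .
    qed
    then show ?thesis unfolding Un[symmetric] by (intro LIMSEQ_le_const2[OF conv]) blast
  qed
  have "AE \<omega> in M. \<exists>m. \<forall>k. \<bar>S m k \<omega>\<bar> < r" if "r > 0" for r
  proof -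
    let ?N = "\<Inter>m. D m r"
    have "prob ?N \<le> tail m / r\<^sup>2" for m
    proof -
      have "prob ?N \<le> prob (D m r)" by (rule finite_measure_mono) auto
      with D_le[OF that] show ?thesis using order_trans by blast
    qed
    moreover have "(\<lambda>m. tail m / r\<^sup>2) \<longlonglongrightarrow> 0" by (rule tendsto_divide_zero[OF tail])
    ultimately have "prob ?N \<le> 0" using LIMSEQ_le_const[of _ 0 "prob ?N"] by blast
    then have "?N \<in> null_sets M"
      by (intro null_setsI) (auto simp: emeasure_eq_measure measure_nonneg antisym)
    then have "AE \<omega> in M. \<omega> \<notin> ?N" by (rule AE_not_in)
    then show ?thesis
    proof (rule AE_mp, intro AE_I2 impI)
      fix \<omega> assume "\<omega> \<in> space M" "\<omega> \<notin> ?N"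
      then show "\<exists>m. \<forall>k. \<bar>S m k \<omega>\<bar> < r" by (auto simp: D_def not_le)
    qed
  qed
  then have "AE \<omega> in M. \<forall>p::nat. \<exists>m. \<forall>k. \<bar>S m k \<omega>\<bar> < 1 / real (Suc p)"
    by (simp add: AE_all_countable del: of_nat_Suc)
  then show ?thesis
  proof (rule AE_mp, intro AE_I2 impI)
    fix \<omega> assume *: "\<forall>p::nat. \<exists>m. \<forall>k. \<bar>S m k \<omega>\<bar> < 1 / real (Suc p)"
    show "summable (\<lambda>k. X k \<omega>)"
      unfolding summable_Cauchy
    proof (intro allI impI)
      fix e :: real assume "e > 0"
      then obtain p where p: "1 / real (Suc p) < e / 2" using nat_approx_posE[of "e / 2"] by auto
      obtain m where m: "\<And>k. \<bar>S m k \<omega>\<bar> < 1 / real (Suc p)" using * by blast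
      have "norm (\<Sum>i\<in>{a..<b}. X i \<omega>) < e" if "a \<ge> m" for a b
      proof (cases "a \<le> b")
        case True
        have S_eq: "(\<Sum>i\<in>{m..<c}. X i \<omega>) = S m (c - m) \<omega>" if "m \<le> c" for c
          using that sum.shift_bounds_nat_ivl[of "\<lambda>i. X i \<omega>" 0 m "c - m"]
          by (simp add: S_def add.commute atLeast0LessThan)
        have "(\<Sum>i\<in>{m..<a}. X i \<omega>) + (\<Sum>i\<in>{a..<b}. X i \<omega>) = (\<Sum>i\<in>{m..<b}. X i \<omega>)"
          by (rule sum.atLeastLessThan_concat) (use that True in auto)
        then have "(\<Sum>i\<in>{a..<b}. X i \<omega>) = S m (b - m) \<omega> - S m (a - m) \<omega>"
          using S_eq[of a] S_eq[of b] that True by simp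
        then have "norm (\<Sum>i\<in>{a..<b}. X i \<omega>) \<le> \<bar>S m (b - m) \<omega>\<bar> + \<bar>S m (a - m) \<omega>\<bar>"
          by (simp only: real_norm_def abs_triangle_ineq4)
        then show ?thesis using m[of "a - m"] m[of "b - m"] p by linarith
      qed (use \<open>e > 0\<close> in simp)
      then show "\<exists>N. \<forall>a\<ge>N. \<forall>b. norm (\<Sum>i\<in>{a..<b}. X i \<omega>) < e" by blast
    qed
  qed
qed

end

section \<open>Distributed stochastic gradient descent\<close>

lemma gderiv_unique:
  assumes "GDERIV f x :> D" "GDERIV f x :> E"
  shows "D = E"
proof -
  have "(\<lambda>h. h \<bullet> D) = (\<lambda>h. h \<bullet> E)"
    using assms unfolding gderiv_def by (rule has_derivative_unique)
  then show ?thesis by (simp add: fun_eq_iff vector_eq_ldot)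
qed

lemma grad_eqI: "GDERIV f x :> D \<Longrightarrow> grad f x = D"
  unfolding grad_def using gderiv_unique by blast

lemma gderiv_grad:
  fixes f :: "'a::euclidean_space \<Rightarrow> real"
  assumes "f differentiable (at x)"
  shows "GDERIV f x :> grad f x"
proof -
  obtain D where D: "(f has_derivative D) (at x)" using assms by (auto simp: differentiable_def)
  have "D h = h \<bullet> adjoint D 1" for h
    using adjoint_works[OF has_derivative_linear[OF D], of h 1] by simp
  then have "D = (\<lambda>h. h \<bullet> adjoint D 1)" by blast
  with D have "GDERIV f x :> adjoint D 1" by (simp add: gderiv_def)
  with grad_eqI show ?thesis by metis
qed

text \<open>Connectedness of a digraph disregards directions; symmetry of the arcs turns it into
  reachability along out-neighbours.\<close>

lemma connected_neighborhoods_neighbors: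
  assumes "graph G" "verts G = UNIV" "Digraph_Component.connected G"
  shows "connected_neighborhoods (neighbors G)"
proof
  interpret graph G by fact
  show "n \<in> neighbors G l" if "l \<in> neighbors G n" for n l
    using that arcs_ends_symmetric[OF sym_arcs] by (auto simp: neighbors_def)
  have "strongly_connected G"
    using sym_arcs assms(3) by (rule symmetric_connected_imp_strongly_connected)
  then have reach: "reachable G n m" for n m using assms(2) by (auto simp: strongly_connected_def)
  show "(n, m) \<in> {(a, b). b \<in> neighbors G a}\<^sup>*" for n m
    using reach[of n m]
  proof (induction rule: reachable_induct)
    case (step a b)
    then show ?case by (auto simp: neighbors_def intro: rtrancl_into_rtrancl)
  qed simp
qed

section \<open>Asymptotics of the step sizes\<close>

lemma bigtheta_powr_tendsto_0:
  fixes a :: "nat \<Rightarrow> real"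
  assumes "a \<in> \<Theta>(\<lambda>k. real k powr (- \<tau>))" "0 < \<tau>"
  shows "a \<longlonglongrightarrow> 0"
proof -
  have "(\<lambda>k. real k powr (- \<tau>)) \<longlonglongrightarrow> 0"
    using assms(2) by (intro tendsto_neg_powr filterlim_real_sequentially) auto
  then have "(\<lambda>k. real k powr (- \<tau>)) \<in> o(\<lambda>_. 1)" by (intro smalloI_tendsto) auto
  then have "a \<in> o(\<lambda>_. 1)" using assms(1) landau_o.big_small_trans bigthetaD1 by blast
  then show ?thesis using smalloD_tendsto by force
qed

lemma bigtheta_powr_not_summable:
  fixes a :: "nat \<Rightarrow> real"
  assumes "a \<in> \<Theta>(\<lambda>k. real k powr (- \<tau>))" "\<tau> \<le> 1" "\<And>k. k \<ge> 1 \<Longrightarrow> 0 < a k"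
  shows "\<not> summable a"
proof
  assume "summable a"
  then have "summable (\<lambda>k. a (k + 1))" by (simp only: summable_iff_shift)
  \<comment> \<open>Positivity starts at index 1, so the passage to absolute values is made on the
    shifted sequence.\<close>
  moreover have "(\<lambda>k. norm (a (k + 1))) = (\<lambda>k. a (k + 1))" using assms(3)[of "Suc _"] by (simp add: less_imp_le)
  ultimately have "summable (\<lambda>k. norm (a (k + 1)))" by simp
  then have "summable (\<lambda>k. norm (a k))" by (subst (asm) summable_iff_shift)
  moreover have "(\<lambda>k. real k powr (- \<tau>)) \<in> O(a)" using assms(1) bigtheta_sym bigthetaD1 by blast
  ultimately have "summable (\<lambda>k. real k powr (- \<tau>))" by (rule summable_comparison_test_bigo)
  with assms(2) show False by (simp add: summable_real_powr_iff)
qed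

lemma bigtheta_powr_square_summable:
  fixes a :: "nat \<Rightarrow> real"
  assumes "a \<in> \<Theta>(\<lambda>k. real k powr (- \<tau>))" "1 / 2 < \<tau>"
  shows "summable (\<lambda>k. (a k)\<^sup>2)"
proof (rule summable_comparison_test_bigo)
  have "norm (real k powr (- (2 * \<tau>))) = real k powr (- (2 * \<tau>))" for k by simp
  then show "summable (\<lambda>k. norm (real k powr (- (2 * \<tau>))))"
    using assms(2) by (simp add: summable_real_powr_iff)
  have "(\<lambda>k. a k * a k) \<in> O(\<lambda>k. real k powr (- \<tau>) * real k powr (- \<tau>))"
    using assms(1) bigthetaD1 by (intro landau_o.big.mult) blast+
  then show "(\<lambda>k. (a k)\<^sup>2) \<in> O(\<lambda>k. real k powr (- (2 * \<tau>)))"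
    by (simp add: power2_eq_square powr_add[symmetric])
qed

lemma bigtheta_powr_ratio_tendsto_0:
  fixes a b :: "nat \<Rightarrow> real"
  assumes "a \<in> \<Theta>(\<lambda>k. real k powr (- \<tau>))" "b \<in> \<Theta>(\<lambda>k. real k powr (- \<sigma>))" "\<sigma> < \<tau>"
  shows "(\<lambda>k. a k / b k) \<longlonglongrightarrow> 0"
proof (rule bigtheta_powr_tendsto_0)
  have "real k powr (- \<tau>) / real k powr (- \<sigma>) = real k powr (- (\<tau> - \<sigma>))" for k
    by (simp add: powr_diff[symmetric])
  then show "(\<lambda>k. a k / b k) \<in> \<Theta>(\<lambda>k. real k powr (- (\<tau> - \<sigma>)))"
    using bigtheta_divide[OF assms(1,2)] by simp
qed (use assms(3) in simp)

lemma summable_vecI: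
  fixes w :: "nat \<Rightarrow> 'a::real_normed_vector ^ 'n::finite"
  assumes "\<And>i. summable (\<lambda>k. w k $ i)"
  shows "summable w"
proof -
  have "w sums (\<chi> i. \<Sum>k. w k $ i)"
    unfolding sums_def
  proof (rule vec_tendstoI)
    show "(\<lambda>n. (\<Sum>k<n. w k) $ i) \<longlonglongrightarrow> (\<chi> i. \<Sum>k. w k $ i) $ i" for i
      using summable_sums[OF assms[of i]] by (simp add: sums_def)
  qed
  then show ?thesis by (rule sums_summable)
qed

section \<open>Histories and moments of the noise\<close>

lemma sets_history:
  "sets (history M x xi k) = sigma_sets (space M)
     (\<Union>j\<in>{1..k}. {x j -` A \<inter> space M | A. A \<in> sets borel} \<union> {xi j -` A \<inter> space M | A. A \<in> sets borel})"
  unfolding history_def by (rule sets_measure_of) auto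

lemma space_history [simp]: "space (history M x xi k) = space M"
  by (simp add: history_def space_measure_of_conv)

lemma history_sub:
  assumes "\<And>k. k \<ge> 1 \<Longrightarrow> x k \<in> borel_measurable M" "\<And>k. k \<ge> 1 \<Longrightarrow> xi k \<in> borel_measurable M"
  shows "subalgebra M (history M x xi k)"
  unfolding subalgebra_def sets_history
  using assms by (auto intro!: sets.sigma_sets_subset measurable_sets)

lemma history_mono: "sets (history M x xi k) \<subseteq> sets (history M x xi (Suc k))"
  unfolding sets_history by (intro sigma_sets_mono' UN_mono) auto

lemma history_noise_measurable:
  assumes "1 \<le> k" shows "xi k \<in> borel_measurable (history M x xi k)"
proof (rule measurableI)
  fix A :: "'b set" assume "A \<in> sets borel"
  then show "xi k -` A \<inter> space (history M x xi k) \<in> sets (history M x xi k)"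
    unfolding sets_history space_history using assms by (auto intro!: sigma_sets.Basic)
qed simp

text \<open>The nonnegative conditional expectation has the same integral as the squared norm, be it
  finite or not, so integrability comes out as a conclusion of the conditional bound.\<close>

lemma (in prob_space) noise_second_moment:
  fixes \<xi> :: "'a \<Rightarrow> real ^ 'd"
  assumes sub: "subalgebra M A" and meas [measurable]: "\<xi> \<in> borel_measurable M" and B: "0 < B"
    and bound: "AE \<omega> in M. nn_cond_exp M A (\<lambda>\<omega>. ennreal ((norm (\<xi> \<omega>))\<^sup>2)) \<omega> \<le> ennreal B"
  shows "integrable M (\<lambda>\<omega>. (\<xi> \<omega> $ i)\<^sup>2)" "expectation (\<lambda>\<omega>. (\<xi> \<omega> $ i)\<^sup>2) \<le> B"
proof -
  interpret finite_measure_subalgebra M A by unfold_locales (rule sub)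
  interpret sigma_finite_subalgebra M A
    by (rule finite_measure_subalgebra_is_sigma_finite) (rule finite_measure_subalgebra_axioms)
  have "(\<integral>\<^sup>+ \<omega>. ennreal ((norm (\<xi> \<omega>))\<^sup>2) \<partial>M)
      = (\<integral>\<^sup>+ \<omega>. nn_cond_exp M A (\<lambda>\<omega>. ennreal ((norm (\<xi> \<omega>))\<^sup>2)) \<omega> \<partial>M)"
    using nn_cond_exp_intg[of "\<lambda>_. 1" "\<lambda>\<omega>. ennreal ((norm (\<xi> \<omega>))\<^sup>2)"] by simp
  also have "\<dots> \<le> (\<integral>\<^sup>+ \<omega>. ennreal B \<partial>M)" by (rule nn_integral_mono_AE[OF bound])
  also have "\<dots> = ennreal B" by (simp add: emeasure_space_1)
  finally have le: "(\<integral>\<^sup>+ \<omega>. ennreal ((norm (\<xi> \<omega>))\<^sup>2) \<partial>M) \<le> ennreal B" .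
  have comp: "(\<xi> \<omega> $ i)\<^sup>2 \<le> (norm (\<xi> \<omega>))\<^sup>2" for \<omega>
    using Finite_Cartesian_Product.norm_nth_le[of "\<xi> \<omega>" i] by (simp add: abs_le_square_iff[symmetric])
  have comp_meas [measurable]: "(\<lambda>\<omega>. \<xi> \<omega> $ i) \<in> borel_measurable M"
    by (rule measurable_compose[OF meas borel_measurable_continuous_onI])
       (intro continuous_on_component continuous_on_id)
  have le': "(\<integral>\<^sup>+ \<omega>. ennreal ((\<xi> \<omega> $ i)\<^sup>2) \<partial>M) \<le> ennreal B"
    by (rule order_trans[OF nn_integral_mono le]) (simp add: comp ennreal_leI)
  show "integrable M (\<lambda>\<omega>. (\<xi> \<omega> $ i)\<^sup>2)"
    using le' by (intro integrableI_nonneg) (auto intro: le_less_trans)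
  show "expectation (\<lambda>\<omega>. (\<xi> \<omega> $ i)\<^sup>2) \<le> B"
    using le' B by (intro integral_real_bounded) auto
qed

theorem theorem1:
  fixes M :: "'w measure"
    and f :: "'n::finite \<Rightarrow> real ^ 'd \<Rightarrow> real"
    and G :: "('n, 'e) pre_digraph"
    and x xi :: "nat \<Rightarrow> 'w \<Rightarrow> real ^ 'd ^ 'n"
    and x0 :: "real ^ 'd ^ 'n"
    and \<alpha> \<beta> :: "nat \<Rightarrow> real"
    and \<tau>\<^sub>\<alpha> \<tau>\<^sub>\<beta> B :: real
  defines "F \<equiv> (\<lambda>y. \<Sum>n\<in>UNIV. f n y)"
  assumes "prob_space M"
    and x_rv: "\<And>k. k \<ge> 1 \<Longrightarrow> x k \<in> borel_measurable M"
    and xi_rv: "\<And>k. k \<ge> 1 \<Longrightarrow> xi k \<in> borel_measurable M"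
    and init: "\<And>\<omega>. \<omega> \<in> space M \<Longrightarrow> x 1 \<omega> = x0"
    and dsgd: "\<And>k n \<omega>. k \<ge> 1 \<Longrightarrow> \<omega> \<in> space M \<Longrightarrow>
        x (k + 1) \<omega> $ n = x k \<omega> $ n
          - \<alpha> k *\<^sub>R (grad (f n) (x k \<omega> $ n) + xi (k + 1) \<omega> $ n)
          + \<beta> k *\<^sub>R (\<Sum>l\<in>neighbors G n. x k \<omega> $ l - x k \<omega> $ n)"
    and alpha_range: "\<And>k. k \<ge> 1 \<Longrightarrow> 0 < \<alpha> k \<and> \<alpha> k \<le> 1"
    and beta_range: "\<And>k. k \<ge> 1 \<Longrightarrow> 0 < \<beta> k \<and> \<beta> k \<le> 1"
    and f_diff: "\<And>n y. f n differentiable (at y)"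
    and grad_cont: "\<And>n. continuous_on UNIV (grad (f n))"
    and grad_lipschitz: "\<And>n. locally_lipschitz (grad (f n))"
    and coercive: "\<And>n. \<exists>R>0. \<exists>C1>0. \<exists>C2>0. \<forall>y. norm y \<ge> R \<longrightarrow>
        (grad (f n) y /\<^sub>R norm (grad (f n) y)) \<bullet> (y /\<^sub>R norm y) \<ge> C1 \<and>
        norm (grad (f n) y) \<le> C2 * norm y"
    and graph_G: "graph G" "verts G = UNIV" "Digraph_Component.connected G"
    and alpha_rate: "\<alpha> \<in> \<Theta>(\<lambda>k. real k powr (- \<tau>\<^sub>\<alpha>))"
    and beta_rate: "\<beta> \<in> \<Theta>(\<lambda>k. real k powr (- \<tau>\<^sub>\<beta>))"
    and exponents: "0 < \<tau>\<^sub>\<beta>" "\<tau>\<^sub>\<beta> < \<tau>\<^sub>\<alpha>" "1 / 2 < \<tau>\<^sub>\<alpha>" "\<tau>\<^sub>\<alpha> \<le> 1"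
    and B_pos: "B > 0"
    and noise_mean: "\<And>k n. k \<ge> 1 \<Longrightarrow>
        AE \<omega> in M. vec_cond_exp M (history M x xi (k - 1)) (\<lambda>\<omega>. xi k \<omega> $ n) \<omega> = 0"
    and noise_moment: "\<And>k n. k \<ge> 1 \<Longrightarrow>
        AE \<omega> in M. nn_cond_exp M (history M x xi (k - 1))
          (\<lambda>\<omega>. ennreal ((norm (xi k \<omega> $ n))\<^sup>2)) \<omega> \<le> ennreal B"
    and dense: "closure (UNIV - F ` critical_points F) = (UNIV :: real set)"
  shows "\<forall>n. AE \<omega> in M.
      (\<forall>l. (\<lambda>k. norm (x k \<omega> $ n - x k \<omega> $ l)) \<longlonglongrightarrow> 0) \<and>
      converges_to_set (\<lambda>k. x k \<omega> $ n) (critical_points F)"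
proof -
  interpret prob_space M by fact
  interpret connected_neighborhoods "neighbors G"
    using graph_G by (rule connected_neighborhoods_neighbors)
  have deriv: "GDERIV (f n) z :> grad (f n) z" for n z
    using f_diff by (rule gderiv_grad)
  have grad_F: "grad F z = (\<Sum>n\<in>UNIV. grad (f n) z)" for z
    unfolding F_def by (intro grad_eqI gderiv_sum deriv)
  then have CP: "critical_points F = {z. (\<Sum>n\<in>UNIV. grad (f n) z) = 0}"
    by (simp add: critical_points_def)
  \<comment> \<open>Time is restarted at 0: index \<open>k\<close> stands for step
    \<open>k + 1\<close> of the process, whose noise is \<open>xi (k + 2)\<close> and whose past is
    the history up to \<open>k + 1\<close>.\<close>
  let ?H = "\<lambda>k. history M x xi (k + 1)"
  define X where "X n i k \<omega> = \<alpha> (k + 1) * (xi (k + 2) \<omega> $ n $ i)" for n i k \<omega>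
  have sub: "subalgebra M (history M x xi k)" for k by (rule history_sub[OF x_rv xi_rv])
  have coord: "(\<lambda>v :: real ^ 'd ^ 'n. v $ n) \<in> borel_measurable borel"
    "(\<lambda>v :: real ^ 'd ^ 'n. v $ n $ i) \<in> borel_measurable borel" for n i
    by (intro borel_measurable_continuous_onI continuous_on_component continuous_on_id)+
  have xi_n: "(\<lambda>\<omega>. xi (k + 2) \<omega> $ n) \<in> borel_measurable M"
    and xi_ni: "(\<lambda>\<omega>. xi (k + 2) \<omega> $ n $ i) \<in> borel_measurable M" for k n i
    using xi_rv[of "k + 2"] coord by (auto intro: measurable_compose)
  have xi_sq: "integrable M (\<lambda>\<omega>. (xi (k + 2) \<omega> $ n $ i)\<^sup>2)"
    and xi_var: "expectation (\<lambda>\<omega>. (xi (k + 2) \<omega> $ n $ i)\<^sup>2) \<le> B" for k n i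
    using noise_second_moment[OF sub xi_n B_pos, of "k + 1" k n] noise_moment[of "k + 2" n] by simp_all
  have X_summable: "AE \<omega> in M. summable (\<lambda>k. X n i k \<omega>)" for n i
  proof -
    interpret martingale_differences M "X n i" ?H
    proof unfold_locales
      fix k
      show "subalgebra M (?H k)" by (rule sub)
      show "sets (?H k) \<subseteq> sets (?H (Suc k))" using history_mono by simp
      have "xi (k + 2) \<in> borel_measurable (?H (Suc k))"
        using history_noise_measurable[of "k + 2" xi M x] by simp
      then have "(\<lambda>\<omega>. xi (k + 2) \<omega> $ n $ i) \<in> borel_measurable (?H (Suc k))"
        using coord(2) by (rule measurable_compose)
      then show "X n i k \<in> borel_measurable (?H (Suc k))"
        unfolding X_def[abs_def] by (intro borel_measurable_times borel_measurable_const)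
      show "integrable M (\<lambda>\<omega>. (X n i k \<omega>)\<^sup>2)"
        unfolding X_def power_mult_distrib using xi_sq by (intro integrable_mult_right)
      interpret finite_measure_subalgebra M "?H k" by unfold_locales (rule sub)
      interpret sigma_finite_subalgebra M "?H k"
        by (rule finite_measure_subalgebra_is_sigma_finite) (rule finite_measure_subalgebra_axioms)
      \<comment> \<open>Integrability of the noise itself, seen as a product of two
        square-integrable functions, one of them constant.\<close>
      have "integrable M (\<lambda>\<omega>. 1 * (xi (k + 2) \<omega> $ n $ i))"
        by (rule integrable_mult_of_square_integrable[OF borel_measurable_const xi_ni _ xi_sq]) simp
      then have "AE \<omega> in M. real_cond_exp M (?H k) (X n i k) \<omega>
          = \<alpha> (k + 1) * real_cond_exp M (?H k) (\<lambda>\<omega>. xi (k + 2) \<omega> $ n $ i) \<omega>"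
        unfolding X_def[abs_def] by (intro real_cond_exp_cmult) simp
      moreover have "AE \<omega> in M. vec_cond_exp M (?H k) (\<lambda>\<omega>. xi (k + 2) \<omega> $ n) \<omega> = 0"
        using noise_mean[of "k + 2" n] by simp
      ultimately show "AE \<omega> in M. real_cond_exp M (?H k) (X n i k) \<omega> = 0"
        by eventually_elim (simp add: vec_cond_exp_def vec_eq_iff)
    qed
    have "summable (\<lambda>k. (\<alpha> k)\<^sup>2)"
      using alpha_rate exponents(3) by (rule bigtheta_powr_square_summable)
    then have "summable (\<lambda>k. (\<alpha> (k + 1))\<^sup>2 * B)"
      by (intro summable_mult2) (simp only: summable_iff_shift[of "\<lambda>k. (\<alpha> k)\<^sup>2"])
    then have "summable (\<lambda>k. expectation (\<lambda>\<omega>. (X n i k \<omega>)\<^sup>2))"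
    proof (rule summable_comparison_test'[where N = 0])
      show "norm (expectation (\<lambda>\<omega>. (X n i k \<omega>)\<^sup>2)) \<le> (\<alpha> (k + 1))\<^sup>2 * B" for k
        using xi_var[of k n i] by (simp add: X_def power_mult_distrib mult_left_mono)
    qed
    then show ?thesis by (rule AE_summable)
  qed
  then have noise: "AE \<omega> in M. \<forall>n i. summable (\<lambda>k. X n i k \<omega>)"
    by (simp add: AE_all_countable)
  have path: "(\<forall>l. (\<lambda>k. norm (x k \<omega> $ n - x k \<omega> $ l)) \<longlonglongrightarrow> 0) \<and>
      converges_to_set (\<lambda>k. x k \<omega> $ n) (critical_points F)"
    if \<omega>: "\<omega> \<in> space M" and summ: "\<forall>n i. summable (\<lambda>k. X n i k \<omega>)" for \<omega> n
  proof -
    define w where "w k = \<alpha> (k + 1) *\<^sub>R xi (k + 2) \<omega>" for k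
    have w: "summable w"
      using summ by (intro summable_vecI) (simp add: w_def X_def)
    have rec: "x (Suc k + 1) \<omega> = x (k + 1) \<omega> - \<beta> (k + 1) *\<^sub>R laplacian (neighbors G) (x (k + 1) \<omega>)
        - \<alpha> (k + 1) *\<^sub>R (\<chi> n. grad (f n) (x (k + 1) \<omega> $ n)) - w k" for k
    proof -
      have "(\<Sum>l\<in>neighbors G n. x (k + 1) \<omega> $ l - x (k + 1) \<omega> $ n) = - laplacian (neighbors G) (x (k + 1) \<omega>) $ n" for n
        by (simp add: laplacian_def sum_negf[symmetric])
      then show ?thesis
        using dsgd[of "k + 1" \<omega>] \<omega>
        by (simp add: vec_eq_iff w_def algebra_simps)
    qed
    have lim: "(\<lambda>k. \<alpha> (k + 1)) \<longlonglongrightarrow> 0" "(\<lambda>k. \<beta> (k + 1)) \<longlonglongrightarrow> 0" "(\<lambda>k. \<alpha> (k + 1) / \<beta> (k + 1)) \<longlonglongrightarrow> 0"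
      using bigtheta_powr_tendsto_0[OF alpha_rate] bigtheta_powr_tendsto_0[OF beta_rate]
        bigtheta_powr_ratio_tendsto_0[OF alpha_rate beta_rate] exponents
      by (intro LIMSEQ_ignore_initial_segment; simp)+
    have nsum: "\<not> summable (\<lambda>k. \<alpha> (k + 1))" "\<not> summable (\<lambda>k. \<beta> (k + 1))"
      unfolding summable_iff_shift
      using bigtheta_powr_not_summable[OF alpha_rate] bigtheta_powr_not_summable[OF beta_rate]
        exponents alpha_range beta_range by simp_all
    have dense': "closure (UNIV - (\<lambda>z. \<Sum>n\<in>UNIV. f n z) ` {z. (\<Sum>n\<in>UNIV. grad (f n) z) = 0}) = (UNIV :: real set)"
      using dense unfolding CP by (simp add: F_def)
    note conv = consensus_descent_converges[of f "\<lambda>n. grad (f n)" "\<lambda>k. x (k + 1) \<omega>", OF deriv grad_cont coercive rec _ _ lim nsum w dense']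
    have pos: "0 < \<alpha> (k + 1)" "0 < \<beta> (k + 1)" for k using alpha_range beta_range by simp_all
    have "(\<lambda>k. norm (x k \<omega> $ n - x k \<omega> $ l)) \<longlonglongrightarrow> 0" for l
      by (rule LIMSEQ_offset[of _ 1]) (rule conv(1)[OF pos])
    moreover have "converges_to_set (\<lambda>k. x k \<omega> $ n) (critical_points F)"
      using conv(2)[OF pos, of n] LIMSEQ_offset[of "\<lambda>k. infdist (x k \<omega> $ n) (critical_points F)" 1 0]
      unfolding CP[symmetric] converges_to_set_def by blast
    ultimately show ?thesis by blast
  qed
  show ?thesis
    by (intro allI, rule AE_mp[OF noise], rule AE_I2) (use path in blast)
qed

end
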